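(* Consider the finite-sum setting of the context, with Assumption A (in particular $F,G$ convex on $X$). Let $\varsigma>0$, $p\in(0,1)$, $q\in\{1,\dots,n\}$, $S=q$, and let $\{x_t\}_{t\ge0}$, $\{z_t\}_{t\ge q}$ be generated by Algorithm IR-FSCG (see context) with $\alpha_t=\log(q)/q$ for $0\le t<q$, $\alpha_t=2/(t+2)$ for $t\ge q$, and $\sigma_t=\varsigma(\max\{t,q\}+1)^{-p}$ for $t\ge0$. Put $c(t,q)=\max\{1,\,q\log(q)/t\}$. Then there is a constant $C>0$, depending only on $L_f,L_g,D,\varsigma,p$ and the quantities $F_{\mathrm{opt}}-\min_{X}F$, $\max_XF-F_{\mathrm{opt}}$, $\max_XG-G_{\mathrm{opt}}$ (not on $t,q,n,\delta$), such that for every $\delta\in(0,1)$, with probability at least $1-\delta$, for every $t\ge q$, $$F(z_t)-F_{\mathrm{opt}}\le C\,c(t,q)\,t^{-(1-p)}\sqrt{\log(16t^2/\delta)},\qquad G(z_t)-G_{\mathrm{opt}}\le C\,t^{-p}\sqrt{\log(16/\delta)}.$$ Moreover, with probability $1$, $$\lim_{t\to\infty}F(x_t)=F_{\mathrm{opt}},\qquad\lim_{t\to\infty}G(x_t)=G_{\mathrm{opt}}.$$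
   Context: Norms are Euclidean; $[m]=\{1,\dots,m\}$. Finite-sum setting: $X\subseteq\mathbb{R}^d$, $F=\frac1n\sum_{i\in[n]}f_i$, $G=\frac1n\sum_{i\in[n]}g_i$. Set $G_{\mathrm{opt}}=\min_{z\in X}G(z)$, $X_{\mathrm{opt}}=\arg\min_{z\in X}G(z)$, $F_{\mathrm{opt}}=\min_{x\in X_{\mathrm{opt}}}F(x)$. Assumption A: (a) $X$ is convex and compact with diameter $D<\infty$, i.e. $\|x-y\|\le D$ for all $x,y\in X$. (b) $F,G$ are convex over $X$ and continuously differentiable on an open neighborhood of $X$. (c) Each $f_i$ is continuously differentiable on an open neighborhood of $X$ with $\|\nabla f_i(x)-\nabla f_i(y)\|\le L_f\|x-y\|$ for $x,y\in X$. (d) Each $g_i$ is continuously differentiable on an open neighborhood of $X$ with $\nabla g_i$ $L_g$-Lipschitz in the same sense. Algorithm IR-FSCG, with parameters $\{\alpha_t\}\subseteq[0,1]$, $\{\sigma_t\}\subset(0,\infty)$, $S,q\in[n]$: start from a (deterministic) $x_0\in X$. For $t=0,1,2,\dots$: if $t\equiv0\pmod q$, put $\widehat{\nabla F}_t=\nabla F(x_t)$, $\widehat{\nabla G}_t=\nabla G(x_t)$; otherwise draw (independently of all previous iterations) $S$ i.i.d. uniform indices $\theta_1,\dots,\theta_S$ from $[n]$ and $S$ i.i.d. uniform indices $\xi_1,\dots,\xi_S$ from $[n]$, and put $\widehat{\nabla F}_t=\widehat{\nabla F}_{t-1}+\frac1S\sum_{j=1}^S(\nabla f_{\theta_j}(x_t)-\nabla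 f_{\theta_j}(x_{t-1}))$, $\widehat{\nabla G}_t=\widehat{\nabla G}_{t-1}+\frac1S\sum_{j=1}^S(\nabla g_{\xi_j}(x_t)-\nabla g_{\xi_j}(x_{t-1}))$. Choose $v_t\in\arg\min_{v\in X}(\sigma_t\widehat{\nabla F}_t+\widehat{\nabla G}_t)^\top v$ (a measurable choice depending only on the samples so far) and set $x_{t+1}=x_t+\alpha_t(v_t-x_t)$. For $t\ge q$ define $S_t=(t+1)t\sigma_t+\sum_{i\in[t]\setminus[q]}(i+1)i(\sigma_{i-1}-\sigma_i)$ and $z_t=\frac1{S_t}\big((t+1)t\sigma_tx_t+\sum_{i\in[t]\setminus[q]}(i+1)i(\sigma_{i-1}-\sigma_i)x_i\big)$ (so $z_q=x_q$). *)

theory Defs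
  imports "HOL-Probability.Probability"
begin

text \<open>
  The constant of the theorem must not depend on the dimension, so all spaces \<open>\<real>\<^sup>d\<close> have to live
  in a single type: the finitely supported real sequences with the Euclidean inner product,
  \<open>\<real>\<^sup>d\<close> being the subspace of sequences supported in \<open>{..<d}\<close>.
\<close>

typedef rseq = "{x :: nat \<Rightarrow> real. finite {i. x i \<noteq> 0}}"
  morphisms coord mk_rseq
  by (rule exI[of _ "\<lambda>_. 0"]) simp

lemma finite_coord [simp]: "finite {i. coord x i \<noteq> 0}"
  using coord[of x] by simp

lemma rseq_eqI: "(\<And>i. coord x i = coord y i) \<Longrightarrow> x = y"
  by (metis coord_inject ext)

instantiation rseq :: real_vector
begin

definition zero_rseq :: rseq where "0 = mk_rseq (\<lambda>_. 0)"
definition plus_rseq :: "rseq \<Rightarrow> rseq \<Rightarrow> rseq"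
  where "x + y = mk_rseq (\<lambda>i. coord x i + coord y i)"
definition uminus_rseq :: "rseq \<Rightarrow> rseq" where "- x = mk_rseq (\<lambda>i. - coord x i)"
definition minus_rseq :: "rseq \<Rightarrow> rseq \<Rightarrow> rseq"
  where "x - y = mk_rseq (\<lambda>i. coord x i - coord y i)"
definition scaleR_rseq :: "real \<Rightarrow> rseq \<Rightarrow> rseq"
  where "r *\<^sub>R x = mk_rseq (\<lambda>i. r * coord x i)"

lemma coord_zero [simp]: "coord 0 i = 0"
  by (simp add: zero_rseq_def mk_rseq_inverse)

lemma coord_plus [simp]: "coord (x + y) i = coord x i + coord y i"
proof -
  have "finite {i. coord x i + coord y i \<noteq> 0}"
    by (rule finite_subset[of _ "{i. coord x i \<noteq> 0} \<union> {i. coord y i \<noteq> 0}"]) auto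
  then show ?thesis by (simp add: plus_rseq_def mk_rseq_inverse)
qed

lemma coord_uminus [simp]: "coord (- x) i = - coord x i"
  by (simp add: uminus_rseq_def mk_rseq_inverse)

lemma coord_minus [simp]: "coord (x - y) i = coord x i - coord y i"
proof -
  have "finite {i. coord x i - coord y i \<noteq> 0}"
    by (rule finite_subset[of _ "{i. coord x i \<noteq> 0} \<union> {i. coord y i \<noteq> 0}"]) auto
  then show ?thesis by (simp add: minus_rseq_def mk_rseq_inverse)
qed

lemma coord_scaleR [simp]: "coord (r *\<^sub>R x) i = r * coord x i"
proof -
  have "finite {i. r * coord x i \<noteq> 0}"
    by (rule finite_subset[of _ "{i. coord x i \<noteq> 0}"]) auto
  then show ?thesis by (simp add: scaleR_rseq_def mk_rseq_inverse)
qed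

instance
  by standard (auto intro!: rseq_eqI simp: algebra_simps)

end

instantiation rseq :: real_inner
begin

definition inner_rseq :: "rseq \<Rightarrow> rseq \<Rightarrow> real"
  where "(x::rseq) \<bullet> y = (\<Sum>i | coord x i \<noteq> 0. coord x i * coord y i)"
definition norm_rseq :: "rseq \<Rightarrow> real" where "norm (x::rseq) = sqrt (x \<bullet> x)"
definition sgn_rseq :: "rseq \<Rightarrow> rseq" where "sgn (x::rseq) = x /\<^sub>R norm x"
definition dist_rseq :: "rseq \<Rightarrow> rseq \<Rightarrow> real" where "dist (x::rseq) y = norm (x - y)"
definition uniformity_rseq :: "(rseq \<times> rseq) filter"
  where "uniformity = (INF e\<in>{0<..}. principal {(x::rseq, y). dist x y < e})"
definition open_rseq :: "rseq set \<Rightarrow> bool"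
  where "open (U::rseq set) \<longleftrightarrow> (\<forall>x\<in>U. eventually (\<lambda>(x', y). x' = x \<longrightarrow> y \<in> U) uniformity)"

lemma inner_rseq_eq:
  assumes "finite A" "{i. coord x i \<noteq> 0} \<inter> {i. coord y i \<noteq> 0} \<subseteq> A"
  shows "x \<bullet> y = (\<Sum>i\<in>A. coord x i * coord y i)"
proof -
  have "x \<bullet> y = (\<Sum>i\<in>{i. coord x i \<noteq> 0} \<union> A. coord x i * coord y i)"
    unfolding inner_rseq_def using assms by (intro sum.mono_neutral_left) auto
  also have "\<dots> = (\<Sum>i\<in>A. coord x i * coord y i)"
    using assms by (intro sum.mono_neutral_right) auto
  finally show ?thesis .
qed

instance
proof
  fix x y z :: rseq and r :: real
  show "dist x y = norm (x - y)" by (fact dist_rseq_def)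
  show "sgn x = x /\<^sub>R norm x" by (fact sgn_rseq_def)
  show "uniformity = (INF e\<in>{0<..}. principal {(x::rseq, y). dist x y < e})"
    by (fact uniformity_rseq_def)
  show "open U \<longleftrightarrow> (\<forall>x\<in>U. eventually (\<lambda>(x', y). x' = x \<longrightarrow> y \<in> U) uniformity)"
    for U :: "rseq set"
    by (fact open_rseq_def)
  let ?A = "{i. coord x i \<noteq> 0} \<union> {i. coord y i \<noteq> 0}"
  have A: "finite ?A" by simp
  show "x \<bullet> y = y \<bullet> x"
    by (subst (1 2) inner_rseq_eq[OF A]) (auto simp: mult.commute)
  have "(x + y) \<bullet> z = (\<Sum>i\<in>?A. coord (x + y) i * coord z i)"
    by (intro inner_rseq_eq A) auto
  also have "\<dots> = (\<Sum>i\<in>?A. coord x i * coord z i) + (\<Sum>i\<in>?A. coord y i * coord z i)"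
    by (simp add: algebra_simps sum.distrib)
  also have "(\<Sum>i\<in>?A. coord x i * coord z i) = x \<bullet> z"
    by (intro inner_rseq_eq[symmetric] A) auto
  also have "(\<Sum>i\<in>?A. coord y i * coord z i) = y \<bullet> z"
    by (intro inner_rseq_eq[symmetric] A) auto
  finally show "(x + y) \<bullet> z = x \<bullet> z + y \<bullet> z" .
  have "(r *\<^sub>R x) \<bullet> y = (\<Sum>i\<in>?A. coord (r *\<^sub>R x) i * coord y i)"
    by (intro inner_rseq_eq A) auto
  also have "\<dots> = r * (\<Sum>i\<in>?A. coord x i * coord y i)"
    by (simp add: sum_distrib_left mult.assoc)
  also have "(\<Sum>i\<in>?A. coord x i * coord y i) = x \<bullet> y"
    by (intro inner_rseq_eq[symmetric] A) auto
  finally show "(r *\<^sub>R x) \<bullet> y = r * (x \<bullet> y)" .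
  show "0 \<le> x \<bullet> x" by (simp add: inner_rseq_def sum_nonneg)
  show "x \<bullet> x = 0 \<longleftrightarrow> x = 0"
    by (auto simp: inner_rseq_def sum_nonneg_eq_0_iff intro!: rseq_eqI)
  show "norm x = sqrt (x \<bullet> x)" by (fact norm_rseq_def)
qed

end

definition rspace :: "nat \<Rightarrow> rseq set"
  where "rspace d = {x. \<forall>i\<ge>d. coord x i = 0}"

lemma subspace_rspace: "subspace (rspace d)"
  by (auto simp: rspace_def subspace_def)

lemma inner_rspace: "x \<in> rspace d \<Longrightarrow> x \<bullet> y = (\<Sum>i<d. coord x i * coord y i)"
  by (rule inner_rseq_eq) (auto simp: rspace_def not_le[symmetric])

text \<open>
  Gradients and open neighbourhoods are taken in \<open>V\<close>, the ambient Euclidean space; lemma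
  \<open>has_gradient_unique\<close> below makes \<open>grad\<close> well defined at points of a subspace \<open>V\<close>.
\<close>

definition has_gradient :: "'a::real_inner set \<Rightarrow> ('a \<Rightarrow> real) \<Rightarrow> 'a \<Rightarrow> 'a \<Rightarrow> bool"
  where "has_gradient V h x u \<longleftrightarrow> u \<in> V \<and> (h has_derivative (\<lambda>w. u \<bullet> w)) (at x within V)"

definition grad :: "'a::real_inner set \<Rightarrow> ('a \<Rightarrow> real) \<Rightarrow> 'a \<Rightarrow> 'a"
  where "grad V h x = (THE u. has_gradient V h x u)"

lemma has_gradient_unique:
  assumes V: "subspace V" "x \<in> V" and u: "has_gradient V h x u" and u': "has_gradient V h x u'"
  shows "u = u'"
proof -
  define w where "w = u - u'"
  have w: "w \<in> V" using u u' V by (simp add: w_def has_gradient_def subspace_diff)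
  let ?l = "\<lambda>t::real. x + t *\<^sub>R w"
  have l: "(?l has_derivative (\<lambda>t. t *\<^sub>R w)) (at 0)"
    by (auto intro!: derivative_eq_intros)
  have sub: "range ?l \<subseteq> V" using V w by (auto intro: subspace_add subspace_scale)
  have D: "((\<lambda>t. h (?l t)) has_derivative (\<lambda>t. a \<bullet> (t *\<^sub>R w))) (at 0)"
    if "has_gradient V h x a" for a
  proof -
    have "(h has_derivative (\<lambda>w. a \<bullet> w)) (at (?l 0) within range ?l)"
      using that sub by (auto simp: has_gradient_def intro: has_derivative_subset)
    from has_derivative_in_compose[OF l this] show ?thesis .
  qed
  have "(\<lambda>t. u \<bullet> (t *\<^sub>R w)) = (\<lambda>t. u' \<bullet> (t *\<^sub>R w))"
    using D[OF u] D[OF u'] by (rule has_derivative_unique)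
  from fun_cong[OF this, of 1] have "w \<bullet> w = 0"
    by (simp add: w_def inner_diff_left)
  then show ?thesis by (simp add: w_def)
qed

definition C1_near :: "'a::real_inner set \<Rightarrow> 'a set \<Rightarrow> ('a \<Rightarrow> real) \<Rightarrow> bool"
  where "C1_near V X h \<longleftrightarrow>
    (\<exists>U. openin (top_of_set V) U \<and> X \<subseteq> U \<and>
         (\<forall>x\<in>U. \<exists>u. has_gradient V h x u) \<and> continuous_on U (grad V h))"

definition avg :: "nat \<Rightarrow> (nat \<Rightarrow> 'a \<Rightarrow> real) \<Rightarrow> 'a \<Rightarrow> real"
  where "avg n h x = (1 / real n) * (\<Sum>i\<in>{1..n}. h i x)"

definition assumption_A ::
  "'a::real_inner set \<Rightarrow> 'a set \<Rightarrow> nat \<Rightarrow> (nat \<Rightarrow> 'a \<Rightarrow> real) \<Rightarrow> (nat \<Rightarrow> 'a \<Rightarrow> real) \<Rightarrow>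
   real \<Rightarrow> real \<Rightarrow> real \<Rightarrow> bool"
  where "assumption_A V X n f g D Lf Lg \<longleftrightarrow>
    X \<subseteq> V \<and> convex X \<and> compact X \<and> (\<forall>x\<in>X. \<forall>y\<in>X. norm (x - y) \<le> D) \<and>
    convex_on X (avg n f) \<and> convex_on X (avg n g) \<and>
    C1_near V X (avg n f) \<and> C1_near V X (avg n g) \<and>
    (\<forall>i\<in>{1..n}. C1_near V X (f i) \<and>
       (\<forall>x\<in>X. \<forall>y\<in>X. norm (grad V (f i) x - grad V (f i) y) \<le> Lf * norm (x - y))) \<and>
    (\<forall>i\<in>{1..n}. C1_near V X (g i) \<and>
       (\<forall>x\<in>X. \<forall>y\<in>X. norm (grad V (g i) x - grad V (g i) y) \<le> Lg * norm (x - y)))"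

definition argmin_set :: "'a set \<Rightarrow> ('a \<Rightarrow> real) \<Rightarrow> 'a set"
  where "argmin_set X h = {x. is_arg_min h (\<lambda>z. z \<in> X) x}"

definition bilevel_opt :: "'a set \<Rightarrow> ('a \<Rightarrow> real) \<Rightarrow> ('a \<Rightarrow> real) \<Rightarrow> real"
  where "bilevel_opt X F G = (INF x\<in>argmin_set X G. F x)"

text \<open>
  \<open>idx t\<close> is the list of the \<open>S\<close> indices drawn at iteration \<open>t\<close>; its entries are numbered from 0.
\<close>

primrec grad_est ::
  "'a::real_inner set \<Rightarrow> nat \<Rightarrow> (nat \<Rightarrow> 'a \<Rightarrow> real) \<Rightarrow> nat \<Rightarrow> nat \<Rightarrow> (nat \<Rightarrow> nat list) \<Rightarrow>
   (nat \<Rightarrow> 'a) \<Rightarrow> nat \<Rightarrow> 'a"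
  where
    "grad_est V n h S q idx x 0 = grad V (avg n h) (x 0)"
  | "grad_est V n h S q idx x (Suc t) =
       (if q dvd Suc t then grad V (avg n h) (x (Suc t))
        else grad_est V n h S q idx x t +
          (1 / real S) *\<^sub>R (\<Sum>j<S. grad V (h (idx (Suc t) ! j)) (x (Suc t)) -
                                 grad V (h (idx (Suc t) ! j)) (x t)))"

definition ir_fscg_path ::
  "'a::real_inner set \<Rightarrow> 'a set \<Rightarrow> nat \<Rightarrow> (nat \<Rightarrow> 'a \<Rightarrow> real) \<Rightarrow> (nat \<Rightarrow> 'a \<Rightarrow> real) \<Rightarrow>
   (nat \<Rightarrow> real) \<Rightarrow> (nat \<Rightarrow> real) \<Rightarrow> nat \<Rightarrow> nat \<Rightarrow> 'a \<Rightarrow>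
   (nat \<Rightarrow> nat list) \<Rightarrow> (nat \<Rightarrow> nat list) \<Rightarrow> (nat \<Rightarrow> 'a) \<Rightarrow> (nat \<Rightarrow> 'a) \<Rightarrow> bool"
  where "ir_fscg_path V X n f g \<alpha> \<sigma> S q x0 \<theta> \<xi> v x \<longleftrightarrow>
    x 0 = x0 \<and>
    (\<forall>t. v t \<in> argmin_set X
           (\<lambda>w. (\<sigma> t *\<^sub>R grad_est V n f S q \<theta> x t + grad_est V n g S q \<xi> x t) \<bullet> w) \<and>
         x (Suc t) = x t + \<alpha> t *\<^sub>R (v t - x t))"

text \<open>
  Probability space of the samples: a point \<open>\<omega>\<close> gives for every iteration \<open>t\<close> the pair \<open>\<omega> t\<close> of the
  index lists for \<open>f\<close> and for \<open>g\<close>, with law \<open>B t\<close>, independently over \<open>t\<close>.  Each of the two lists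
  is i.i.d. uniform; their joint law is left arbitrary, which covers the case where they
  are independent of each other.
\<close>

type_synonym sample_path = "nat \<Rightarrow> nat list \<times> nat list"

definition uniform_batches :: "nat \<Rightarrow> nat \<Rightarrow> (nat \<Rightarrow> (nat list \<times> nat list) pmf) \<Rightarrow> bool"
  where "uniform_batches n S B \<longleftrightarrow>
    (\<forall>t. map_pmf fst (B t) = replicate_pmf S (pmf_of_set {1..n}) \<and>
         map_pmf snd (B t) = replicate_pmf S (pmf_of_set {1..n}))"

definition sample_measure :: "(nat \<Rightarrow> (nat list \<times> nat list) pmf) \<Rightarrow> sample_path measure"
  where "sample_measure B = (\<Pi>\<^sub>M t\<in>UNIV. measure_pmf (B t))"

text \<open>
  No samples are drawn at iterations divisible by \<open>q\<close>, so those entries of \<open>\<omega>\<close> must not be used.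
  Measurability of \<open>v t\<close> follows, because \<open>v t\<close> factors through finitely many
  coordinates with values in a countable discrete space.
\<close>

definition nonanticipating :: "nat \<Rightarrow> (nat \<Rightarrow> sample_path \<Rightarrow> 'a) \<Rightarrow> bool"
  where "nonanticipating q v \<longleftrightarrow>
    (\<forall>t \<omega> \<omega>'. (\<forall>s\<le>t. \<not> q dvd s \<longrightarrow> \<omega> s = \<omega>' s) \<longrightarrow> v t \<omega> = v t \<omega>')"

definition ir_fscg ::
  "'a::real_inner set \<Rightarrow> 'a set \<Rightarrow> nat \<Rightarrow> (nat \<Rightarrow> 'a \<Rightarrow> real) \<Rightarrow> (nat \<Rightarrow> 'a \<Rightarrow> real) \<Rightarrow>
   (nat \<Rightarrow> real) \<Rightarrow> (nat \<Rightarrow> real) \<Rightarrow> nat \<Rightarrow> nat \<Rightarrow> 'a \<Rightarrow>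
   (nat \<Rightarrow> sample_path \<Rightarrow> 'a) \<Rightarrow> (nat \<Rightarrow> sample_path \<Rightarrow> 'a) \<Rightarrow> bool"
  where "ir_fscg V X n f g \<alpha> \<sigma> S q x0 v x \<longleftrightarrow>
    x0 \<in> X \<and> nonanticipating q v \<and>
    (\<forall>\<omega>. ir_fscg_path V X n f g \<alpha> \<sigma> S q x0 (\<lambda>t. fst (\<omega> t)) (\<lambda>t. snd (\<omega> t))
            (\<lambda>t. v t \<omega>) (\<lambda>t. x t \<omega>))"

definition S_weight :: "(nat \<Rightarrow> real) \<Rightarrow> nat \<Rightarrow> nat \<Rightarrow> real"
  where "S_weight \<sigma> q t =
    real ((t + 1) * t) * \<sigma> t +
    (\<Sum>i\<in>{1..t} - {1..q}. real ((i + 1) * i) * (\<sigma> (i - 1) - \<sigma> i))"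

definition z_avg :: "(nat \<Rightarrow> real) \<Rightarrow> nat \<Rightarrow> (nat \<Rightarrow> 'a::real_vector) \<Rightarrow> nat \<Rightarrow> 'a"
  where "z_avg \<sigma> q x t = (1 / S_weight \<sigma> q t) *\<^sub>R
    ((real ((t + 1) * t) * \<sigma> t) *\<^sub>R x t +
     (\<Sum>i\<in>{1..t} - {1..q}. (real ((i + 1) * i) * (\<sigma> (i - 1) - \<sigma> i)) *\<^sub>R x i))"

definition step_alpha :: "nat \<Rightarrow> nat \<Rightarrow> real"
  where "step_alpha q t = (if t < q then ln (real q) / real q else 2 / (real t + 2))"

definition reg_sigma :: "real \<Rightarrow> real \<Rightarrow> nat \<Rightarrow> nat \<Rightarrow> real"
  where "reg_sigma \<zeta> p q t = \<zeta> * (real (max t q) + 1) powr (- p)"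

definition c_fac :: "nat \<Rightarrow> nat \<Rightarrow> real"
  where "c_fac t q = max 1 (real q * ln (real q) / real t)"

end

theory Submission
  imports Defs
begin

text \<open>
  Let \<open>x*\<close> solve the bilevel problem, and write \<open>a t = F (x t) - F x*\<close>, \<open>b t = G (x t) - G x*\<close>.
  A conditional gradient step for the regularised objective \<open>\<sigma> t F + G\<close> contracts
  \<open>\<sigma> t a t + b t\<close> by the factor \<open>1 - \<alpha> t\<close>, up to a curvature term of order \<open>(\<alpha> t)\<^sup>2\<close> and
  \<open>\<alpha> t\<close> times the gradient error (\<open>inexact_conditional_gradient_step\<close>).  For \<open>\<alpha> t = 2 / (t + 2)\<close>,
  multiplying by \<open>(t + 1) (t + 2)\<close> makes the contraction telescope.  What is left over is the change
  of \<open>\<sigma>\<close>, and it produces exactly the weights that define \<open>z\<close> (\<open>weighted_descent\<close>):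

  \<open>(T + 1) T \<sigma> T a T + \<Sum>\<^sub>i (i + 1) i (\<sigma> (i - 1) - \<sigma> i) a i + (T + 1) T b T\<close>
  is bounded by the accumulated noise.

  If the gradient error at time \<open>t\<close> is of order \<open>sqrt (log t) / t\<close>, the accumulated noise is of order
  \<open>c(T, q) T sqrt (log T)\<close>, whereas the weights sum to order \<open>T powr (2 - p)\<close>.  All rates follow from
  this one inequality.  Convexity of \<open>F\<close> gives the rate of \<open>F (z T)\<close>.  Since \<open>a\<close> is bounded below, the
  inequality also bounds \<open>b T\<close> by a multiple of \<open>T powr - p\<close>, because the logarithms are absorbed
  by \<open>T powr (1 - p)\<close>; averaging these bounds with the same weights gives the rate of \<open>G (z T)\<close>.
  For the last iterate, \<open>b T\<close> tends to 0, so by compactness the negative part of \<open>a\<close> tends to 0;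
  hence the sum in the inequality is at least \<open>- o(T powr (2 - p))\<close>, and the first summand forces
  \<open>limsup a T \<le> 0\<close> (\<open>last_iterate_limit\<close>).

  The probabilistic input is a sub-Gaussian tail for the gradient error whose constants do not depend
  on the dimension.  Within an epoch the error is a martingale, each sample contributing a bounded
  centred vector.  Instead of a vector-valued Azuma inequality, the exponential moment of the
  squared norm is followed directly: conditioning on the past, the cross term is a bounded centred
  real variable, to which Hoeffding's lemma applies, and slowly increasing the denominator in the
  exponent absorbs the gain (\<open>exp_square_norm_step\<close>).  A union bound over all times with
  failure probabilities that sum to \<open>\<delta>\<close> gives one event (\<open>accurate\<close>) on which the rest of the
  argument is deterministic.
\<close>

section \<open>Exponential moments of squared norms\<close>

text \<open>
  Expanding the square leaves \<open>norm y ^ 2 + b ^ 2\<close> and the cross term \<open>2 * (y \<bullet> a i)\<close>.  By Hoeffding's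
  lemma the exponential moment of the cross term costs only a further multiple of \<open>norm y ^ 2\<close>, and the
  larger denominator on the left pays for it.
\<close>

lemma exp_square_norm_step:
  fixes y :: "'b::real_inner"
  assumes I: "finite I" "I \<noteq> {}" and mean: "(\<Sum>i\<in>I. a i) = 0"
    and bound: "\<And>i. i \<in> I \<Longrightarrow> norm (a i) \<le> b" and \<Lambda>: "\<Lambda> > 0"
  shows "(\<integral>\<^sup>+i. ennreal (exp ((norm (y + a i))\<^sup>2 / (\<Lambda> + 2 * b\<^sup>2))) \<partial>pmf_of_set I)
         \<le> ennreal (exp (b\<^sup>2 / \<Lambda>) * exp ((norm y)\<^sup>2 / \<Lambda>))"
proof -
  have b: "b \<ge> 0" using I bound norm_ge_zero order_trans by blast
  define l where "l = 1 / (\<Lambda> + 2 * b\<^sup>2)"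
  have l: "0 < l" "l \<le> 1 / \<Lambda>"
    using \<Lambda> by (auto simp: l_def add_pos_nonneg intro!: divide_left_mono mult_pos_pos)
  have cross: "\<bar>2 * l * (y \<bullet> a i)\<bar> \<le> 2 * l * norm y * b" if "i \<in> I" for i
  proof -
    have "\<bar>y \<bullet> a i\<bar> \<le> norm y * b"
      using Cauchy_Schwarz_ineq2[of y "a i"] mult_left_mono[OF bound[OF that], of "norm y"]
      by simp
    then have "2 * l * \<bar>y \<bullet> a i\<bar> \<le> 2 * l * (norm y * b)"
      using l by (intro mult_left_mono) auto
    then show ?thesis using l by (simp add: abs_mult mult.assoc)
  qed
  interpret interval_bounded_random_variable "measure_pmf (pmf_of_set I)"
    "\<lambda>i. 2 * l * (y \<bullet> a i)" "- (2 * l * norm y * b)" "2 * l * norm y * b"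
  proof
    show "AE i in measure_pmf (pmf_of_set I). 2 * l * (y \<bullet> a i) \<in> {- (2 * l * norm y * b)..2 * l * norm y * b}"
      using I cross unfolding AE_measure_pmf_iff by (metis abs_le_iff atLeastAtMost_iff minus_le_iff set_pmf_of_set)
  qed simp
  have "(\<Sum>i\<in>I. 2 * l * (y \<bullet> a i)) = 0"
    using mean by (simp add: sum_distrib_left[symmetric] inner_sum_right[symmetric])
  then have "integral\<^sup>L (measure_pmf (pmf_of_set I)) (\<lambda>i. 2 * l * (y \<bullet> a i)) = 0"
    using integral_pmf_of_set[OF I(2,1), of "\<lambda>i. 2 * l * (y \<bullet> a i)"] by simp
  from Hoeffdings_lemma_nn_integral_0[OF zero_less_one this]
  have hoeff: "(\<integral>\<^sup>+i. ennreal (exp (2 * l * (y \<bullet> a i))) \<partial>pmf_of_set I)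
      \<le> ennreal (exp (2 * l\<^sup>2 * b\<^sup>2 * (norm y)\<^sup>2))"
    by (simp add: power2_eq_square algebra_simps)
  have pointwise: "exp ((norm (y + a i))\<^sup>2 / (\<Lambda> + 2 * b\<^sup>2))
      \<le> exp (l * (norm y)\<^sup>2 + l * b\<^sup>2) * exp (2 * l * (y \<bullet> a i))" if "i \<in> I" for i
  proof -
    have "(norm (a i))\<^sup>2 \<le> b\<^sup>2"
      using bound[OF that] by (simp add: power_mono)
    then have "(norm (y + a i))\<^sup>2 \<le> (norm y)\<^sup>2 + b\<^sup>2 + 2 * (y \<bullet> a i)"
      by (simp add: power2_norm_eq_inner inner_simps inner_commute)
    then have "l * (norm (y + a i))\<^sup>2 \<le> l * ((norm y)\<^sup>2 + b\<^sup>2 + 2 * (y \<bullet> a i))"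
      using l by (intro mult_left_mono) auto
    then show ?thesis by (simp add: l_def exp_add[symmetric] algebra_simps add_divide_distrib)
  qed
  \<comment> \<open>The choice of the new denominator makes the quadratic gain of Hoeffding's lemma telescope.\<close>
  have "l + 2 * l\<^sup>2 * b\<^sup>2 \<le> 1 / \<Lambda>"
  proof -
    have "1 / \<Lambda> - l = 2 * b\<^sup>2 * l * (1 / \<Lambda>)"
    proof -
      have "l * (\<Lambda> + 2 * b\<^sup>2) = 1" using \<Lambda> by (simp add: l_def add_pos_nonneg less_imp_neq[symmetric])
      then show ?thesis using \<Lambda> by (simp add: field_simps)
    qed
    moreover have "2 * b\<^sup>2 * l * l \<le> 2 * b\<^sup>2 * l * (1 / \<Lambda>)"
      using l by (intro mult_left_mono) auto
    moreover have "2 * l\<^sup>2 * b\<^sup>2 = 2 * b\<^sup>2 * l * l" by (simp add: power2_eq_square)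
    ultimately show ?thesis by linarith
  qed
  then have "(l + 2 * l\<^sup>2 * b\<^sup>2) * (norm y)\<^sup>2 \<le> 1 / \<Lambda> * (norm y)\<^sup>2"
    by (intro mult_right_mono) auto
  moreover have "l * b\<^sup>2 \<le> 1 / \<Lambda> * b\<^sup>2" using l by (intro mult_right_mono) auto
  ultimately have expo: "exp (l * (norm y)\<^sup>2 + l * b\<^sup>2) * exp (2 * l\<^sup>2 * b\<^sup>2 * (norm y)\<^sup>2)
      \<le> exp (b\<^sup>2 / \<Lambda>) * exp ((norm y)\<^sup>2 / \<Lambda>)"
    by (simp add: exp_add[symmetric] algebra_simps)
  have "(\<integral>\<^sup>+i. ennreal (exp ((norm (y + a i))\<^sup>2 / (\<Lambda> + 2 * b\<^sup>2))) \<partial>pmf_of_set I)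
      \<le> (\<integral>\<^sup>+i. ennreal (exp (l * (norm y)\<^sup>2 + l * b\<^sup>2)) * ennreal (exp (2 * l * (y \<bullet> a i))) \<partial>pmf_of_set I)"
    using I pointwise
    by (intro nn_integral_mono_AE) (auto simp: AE_measure_pmf_iff ennreal_mult[symmetric] intro!: ennreal_leI)
  also have "\<dots> \<le> ennreal (exp (l * (norm y)\<^sup>2 + l * b\<^sup>2)) * ennreal (exp (2 * l\<^sup>2 * b\<^sup>2 * (norm y)\<^sup>2))"
    by (subst nn_integral_cmult) (auto intro!: mult_left_mono hoeff)
  also have "\<dots> \<le> ennreal (exp (b\<^sup>2 / \<Lambda>) * exp ((norm y)\<^sup>2 / \<Lambda>))"
    using expo by (simp add: ennreal_mult[symmetric] ennreal_leI)
  finally show ?thesis .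
qed

text \<open>
  The samples of a batch are drawn one after the other, so the one-sample bound is applied \<open>S\<close> times.
  The denominators form an arithmetic progression, so that after \<open>N\<close> samples one may start from
  \<open>\<Lambda> = 2 N b ^ 2\<close> and still end with a denominator of the order of the variance \<open>N b ^ 2\<close>.
\<close>

lemma exp_square_norm_batch:
  fixes y :: "'b::real_inner"
  assumes I: "finite I" "I \<noteq> {}" and mean: "(\<Sum>i\<in>I. a i) = 0"
    and bound: "\<And>i. i \<in> I \<Longrightarrow> norm (a i) \<le> b" and \<Lambda>: "\<Lambda> > 0"
  shows "(\<integral>\<^sup>+l. ennreal (exp ((norm (y + (\<Sum>j<S. a (l ! j))))\<^sup>2 / (\<Lambda> + real S * (2 * b\<^sup>2))))
            \<partial>replicate_pmf S (pmf_of_set I))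
         \<le> ennreal (exp (real S * b\<^sup>2 / \<Lambda>) * exp ((norm y)\<^sup>2 / \<Lambda>))"
  using \<Lambda>
proof (induction S arbitrary: y \<Lambda>)
  case 0
  then show ?case by simp
next
  case (Suc S)
  let ?\<Lambda>' = "\<Lambda> + 2 * b\<^sup>2"
  have \<Lambda>': "?\<Lambda>' > 0" using Suc.prems by (simp add: add_pos_nonneg)
  have "(\<integral>\<^sup>+l. ennreal (exp ((norm (y + (\<Sum>j<Suc S. a (l ! j))))\<^sup>2 / (\<Lambda> + real (Suc S) * (2 * b\<^sup>2))))
            \<partial>replicate_pmf (Suc S) (pmf_of_set I))
      = (\<integral>\<^sup>+i. (\<integral>\<^sup>+l. ennreal (exp ((norm ((y + a i) + (\<Sum>j<S. a (l ! j))))\<^sup>2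
              / (?\<Lambda>' + real S * (2 * b\<^sup>2)))) \<partial>replicate_pmf S (pmf_of_set I)) \<partial>pmf_of_set I)"
    by (simp add: sum.lessThan_Suc_shift algebra_simps del: sum.lessThan_Suc)
  also have "\<dots> \<le> (\<integral>\<^sup>+i. ennreal (exp (real S * b\<^sup>2 / ?\<Lambda>')) *
        ennreal (exp ((norm (y + a i))\<^sup>2 / ?\<Lambda>')) \<partial>pmf_of_set I)"
    using Suc.IH[OF \<Lambda>'] by (intro nn_integral_mono) (simp add: ennreal_mult)
  also have "\<dots> \<le> ennreal (exp (real S * b\<^sup>2 / ?\<Lambda>')) * ennreal (exp (b\<^sup>2 / \<Lambda>) * exp ((norm y)\<^sup>2 / \<Lambda>))"
    by (subst nn_integral_cmult) (auto intro!: mult_left_mono exp_square_norm_step assms Suc.prems)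
  also have "\<dots> \<le> ennreal (exp (real S * b\<^sup>2 / \<Lambda>)) * ennreal (exp (b\<^sup>2 / \<Lambda>) * exp ((norm y)\<^sup>2 / \<Lambda>))"
    using Suc.prems by (intro mult_right_mono ennreal_leI) (auto intro!: divide_left_mono mult_pos_pos add_pos_nonneg)
  also have "\<dots> = ennreal (exp (real (Suc S) * b\<^sup>2 / \<Lambda>) * exp ((norm y)\<^sup>2 / \<Lambda>))"
    by (simp add: ennreal_mult[symmetric] exp_add[symmetric] algebra_simps add_divide_distrib)
  finally show ?case .
qed

section \<open>Sample paths and resampling\<close>

lemma prob_space_sample_measure: "prob_space (sample_measure B)"
  unfolding sample_measure_def by (intro prob_space_PiM) (rule prob_space_measure_pmf)

lemma space_sample_measure [simp]: "space (sample_measure B) = UNIV"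
  by (simp add: sample_measure_def space_PiM)

text \<open>
  Being adapted, in a form that yields measurability for free (\<open>measurable_depends_below\<close>) and makes
  conditioning on the past a mere change of one coordinate (\<open>nn_integral_resample\<close>).
\<close>

definition depends_below :: "nat \<Rightarrow> (sample_path \<Rightarrow> 'c) \<Rightarrow> bool"
  where "depends_below m h \<longleftrightarrow> (\<forall>\<omega> \<omega>'. (\<forall>s<m. \<omega> s = \<omega>' s) \<longrightarrow> h \<omega> = h \<omega>')"

lemma depends_belowD: "depends_below m h \<Longrightarrow> (\<And>s. s < m \<Longrightarrow> \<omega> s = \<omega>' s) \<Longrightarrow> h \<omega> = h \<omega>'"
  by (auto simp: depends_below_def)

lemma depends_below_mono: "depends_below m h \<Longrightarrow> m \<le> m' \<Longrightarrow> depends_below m' h"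
  unfolding depends_below_def by (metis order_less_le_trans)

lemma depends_below_comp: "depends_below m h \<Longrightarrow> depends_below m (\<lambda>\<omega>. H (h \<omega>))"
  unfolding depends_below_def by metis

lemma depends_below_comp2:
  "depends_below m h \<Longrightarrow> depends_below m h' \<Longrightarrow> depends_below m (\<lambda>\<omega>. H (h \<omega>) (h' \<omega>))"
  unfolding depends_below_def by metis

text \<open>
  Such a function factors through the list of the first \<open>m\<close> coordinates.  These lists form a
  countable type, so measurability comes down to that of cylinder sets.
\<close>

lemma measurable_depends_below:
  fixes h :: "sample_path \<Rightarrow> 'c"
  assumes "depends_below m h" "\<And>\<omega>. h \<omega> \<in> space N"
  shows "h \<in> measurable (sample_measure B) N"
proof -
  let ?pre = "\<lambda>\<omega>::sample_path. map \<omega> [0..<m]"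
  let ?ext = "\<lambda>l s. l ! s :: nat list \<times> nat list"
  have "?pre \<in> measurable (sample_measure B) (count_space UNIV)"
  proof (subst measurable_count_space_eq2_countable, safe)
    fix l :: "(nat list \<times> nat list) list"
    have "(\<lambda>\<omega>. \<omega> s) -` {l ! s} \<inter> space (sample_measure B) \<in> sets (sample_measure B)" for s
      unfolding sample_measure_def
      by (rule measurable_sets[OF measurable_component_singleton[of s UNIV]]) auto
    then have "space (sample_measure B) \<inter> (\<Inter>s\<in>{..<m}. (\<lambda>\<omega>. \<omega> s) -` {l ! s} \<inter> space (sample_measure B))
        \<in> sets (sample_measure B)"
      using sets.top[of "sample_measure B"]
      by (cases "m = 0") (auto intro!: sets.Int sets.finite_INT)
    then have "(if length l = m then \<Inter>s\<in>{..<m}. (\<lambda>\<omega>. \<omega> s) -` {l ! s} else {}) \<in> sets (sample_measure B)"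
      by simp
    also have "(if length l = m then \<Inter>s\<in>{..<m}. (\<lambda>\<omega>. \<omega> s) -` {l ! s} else {})
        = ?pre -` {l} \<inter> space (sample_measure B)"
    proof (rule set_eqI)
      fix \<omega> :: sample_path
      have "map \<omega> [0..<m] = l \<longleftrightarrow> length l = m \<and> (\<forall>s<m. \<omega> s = l ! s)"
        unfolding list_eq_iff_nth_eq by simp (metis)
      then show "\<omega> \<in> (if length l = m then \<Inter>s\<in>{..<m}. (\<lambda>\<omega>. \<omega> s) -` {l ! s} else {})
          \<longleftrightarrow> \<omega> \<in> ?pre -` {l} \<inter> space (sample_measure B)"
        by simp (metis lessThan_iff)
    qed
    finally show "?pre -` {l} \<inter> space (sample_measure B) \<in> sets (sample_measure B)" .
  qed (auto)
  moreover have "(\<lambda>l. h (?ext l)) \<in> measurable (count_space UNIV) N"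
    using assms(2) by simp
  ultimately have "(\<lambda>\<omega>. h (?ext (?pre \<omega>))) \<in> measurable (sample_measure B) N"
    by (rule measurable_compose)
  moreover have "h (?ext (?pre \<omega>)) = h \<omega>" for \<omega>
    by (rule depends_belowD[OF assms(1)]) simp
  ultimately show ?thesis by simp
qed

lemma sets_depends_below: "depends_below m P \<Longrightarrow> {\<omega>. P \<omega>} \<in> sets (sample_measure B)"
  using predE[OF measurable_depends_below[of m P "count_space UNIV" B]] by simp

text \<open>
  Redrawing coordinate \<open>m\<close> independently does not change the law of the path.  For an \<open>h\<close> that depends
  on the coordinates up to \<open>m\<close>, the inner integral is the conditional expectation given the
  coordinates below \<open>m\<close>.
\<close>

lemma nn_integral_resample:
  fixes h :: "sample_path \<Rightarrow> ennreal"
  assumes h: "h \<in> borel_measurable (sample_measure B)"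
  shows "(\<integral>\<^sup>+\<omega>. h \<omega> \<partial>sample_measure B) = (\<integral>\<^sup>+\<omega>. (\<integral>\<^sup>+b. h (fun_upd \<omega> m b) \<partial>B m) \<partial>sample_measure B)"
proof -
  let ?M = "\<Pi>\<^sub>M t\<in>UNIV. measure_pmf (B t)"
  interpret P: prob_space ?M by (intro prob_space_PiM) (rule prob_space_measure_pmf)
  interpret pair_sigma_finite "measure_pmf (B m)" ?M ..
  have h': "h \<in> borel_measurable ?M" using h by (simp add: sample_measure_def)
  have upd: "(\<lambda>(x, X). fun_upd X m x) \<in> measurable (measure_pmf (B m) \<Otimes>\<^sub>M ?M) ?M"
    unfolding case_prod_unfold by (rule measurable_fun_upd[of UNIV UNIV m]) auto
  have "distr (measure_pmf (B m) \<Otimes>\<^sub>M ?M) ?M (\<lambda>(x, X). fun_upd X m x) = ?M"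
    using distr_pair_PiM_eq_PiM[of UNIV "\<lambda>t. measure_pmf (B t)" m]
    by (simp add: prob_space_measure_pmf)
  then have "(\<integral>\<^sup>+\<omega>. h \<omega> \<partial>?M) = (\<integral>\<^sup>+p. h ((\<lambda>(x, X). fun_upd X m x) p) \<partial>(measure_pmf (B m) \<Otimes>\<^sub>M ?M))"
    using nn_integral_distr[OF upd, of h] h' by simp
  also have "\<dots> = (\<integral>\<^sup>+\<omega>. (\<integral>\<^sup>+b. h (fun_upd \<omega> m b) \<partial>B m) \<partial>?M)"
    using measurable_compose[OF upd h'] by (subst nn_integral_snd[symmetric]) (auto simp: case_prod_unfold)
  finally show ?thesis by (simp add: sample_measure_def)
qed

section \<open>Concentration of the recursive gradient estimator\<close>

text \<open>
  One gradient estimator along an arbitrary adapted sequence \<open>x\<close> in \<open>X\<close>.  The projection \<open>proj\<close> selects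
  which of the two index lists drives it, so that the results serve both the outer and the inner
  objective, whatever the joint law of the two lists.
\<close>

locale variance_reduced =
  fixes V X :: "'b::real_inner set" and n q :: nat and h :: "nat \<Rightarrow> 'b \<Rightarrow> real"
    and L :: real and B :: "nat \<Rightarrow> (nat list \<times> nat list) pmf"
    and proj :: "nat list \<times> nat list \<Rightarrow> nat list"
    and x :: "nat \<Rightarrow> sample_path \<Rightarrow> 'b" and \<eta> :: "nat \<Rightarrow> real"
  assumes n_pos: "0 < n" and q_pos: "0 < q" and L_nonneg: "0 \<le> L"
    and mean_grad: "\<And>y. y \<in> X \<Longrightarrow> real n *\<^sub>R grad V (avg n h) y = (\<Sum>i\<in>{1..n}. grad V (h i) y)"
    and lipschitz: "\<And>i y z. i \<in> {1..n} \<Longrightarrow> y \<in> X \<Longrightarrow> z \<in> X \<Longrightarrow>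
      norm (grad V (h i) y - grad V (h i) z) \<le> L * norm (y - z)"
    and batch_law: "\<And>t. map_pmf proj (B t) = replicate_pmf q (pmf_of_set {1..n})"
    and x_in: "\<And>t \<omega>. x t \<omega> \<in> X"
    and x_adapted: "\<And>t. depends_below t (x t)"
    and x_step: "\<And>t \<omega>. norm (x (Suc t) \<omega> - x t \<omega>) \<le> \<eta> t"
begin

abbreviation M :: "sample_path measure" where "M \<equiv> sample_measure B"

definition err :: "nat \<Rightarrow> sample_path \<Rightarrow> 'b"
  where "err t \<omega> = grad_est V n h q q (\<lambda>s. proj (\<omega> s)) (\<lambda>s. x s \<omega>) t - grad V (avg n h) (x t \<omega>)"

lemma err_restart: "q dvd t \<Longrightarrow> err t \<omega> = 0"
  by (cases t) (simp_all add: err_def)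

text \<open>
  The contribution of drawing index \<open>i\<close> to the error at time \<open>t + 1\<close>, including the factor \<open>1 / q\<close>.
\<close>

definition centred :: "nat \<Rightarrow> sample_path \<Rightarrow> nat \<Rightarrow> 'b"
  where "centred t \<omega> i = (1 / real q) *\<^sub>R
    ((grad V (h i) (x (Suc t) \<omega>) - grad V (h i) (x t \<omega>)) -
     (grad V (avg n h) (x (Suc t) \<omega>) - grad V (avg n h) (x t \<omega>)))"

lemma err_Suc:
  assumes "\<not> q dvd Suc t"
  shows "err (Suc t) \<omega> = err t \<omega> + (\<Sum>j<q. centred t \<omega> (proj (\<omega> (Suc t)) ! j))"
proof -
  let ?d = "\<lambda>j. grad V (h (proj (\<omega> (Suc t)) ! j)) (x (Suc t) \<omega>) - grad V (h (proj (\<omega> (Suc t)) ! j)) (x t \<omega>)"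
  let ?D = "grad V (avg n h) (x (Suc t) \<omega>) - grad V (avg n h) (x t \<omega>)"
  have "(\<Sum>j<q. centred t \<omega> (proj (\<omega> (Suc t)) ! j)) = (1 / real q) *\<^sub>R (\<Sum>j<q. ?d j - ?D)"
    by (simp only: centred_def scaleR_sum_right)
  also have "\<dots> = (1 / real q) *\<^sub>R (\<Sum>j<q. ?d j) - ?D"
    using q_pos by (simp add: sum_subtractf[of ?d "\<lambda>_. ?D"] sum_constant_scaleR scaleR_diff_right
        del: sum_subtractf)
  finally show ?thesis using assms by (simp add: err_def)
qed

lemma sum_centred: "(\<Sum>i\<in>{1..n}. centred t \<omega> i) = 0"
proof -
  have "(\<Sum>i\<in>{1..n}. centred t \<omega> i) = (1 / real q) *\<^sub>R
      (((\<Sum>i\<in>{1..n}. grad V (h i) (x (Suc t) \<omega>)) - (\<Sum>i\<in>{1..n}. grad V (h i) (x t \<omega>))) -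
       (real n *\<^sub>R grad V (avg n h) (x (Suc t) \<omega>) - real n *\<^sub>R grad V (avg n h) (x t \<omega>)))"
    by (simp add: centred_def scaleR_sum_right[symmetric] sum_subtractf sum_constant_scaleR
        scaleR_diff_right)
  then show ?thesis by (simp only: mean_grad[OF x_in] diff_self scaleR_zero_right)
qed

lemma norm_centred:
  assumes i: "i \<in> {1..n}"
  shows "norm (centred t \<omega> i) \<le> 2 * L * \<eta> t / real q"
proof -
  let ?d = "\<lambda>i. grad V (h i) (x (Suc t) \<omega>) - grad V (h i) (x t \<omega>)"
  let ?D = "grad V (avg n h) (x (Suc t) \<omega>) - grad V (avg n h) (x t \<omega>)"
  have d: "norm (?d i) \<le> L * \<eta> t" if "i \<in> {1..n}" for i
    using lipschitz[OF that x_in x_in] mult_left_mono[OF x_step L_nonneg] order_trans by blast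
  have "real n *\<^sub>R ?D = (\<Sum>i\<in>{1..n}. ?d i)"
    by (simp add: scaleR_diff_right mean_grad x_in sum_subtractf)
  then have "real n * norm ?D = norm (\<Sum>i\<in>{1..n}. ?d i)"
    by (metis abs_of_nat norm_scaleR)
  also have "\<dots> \<le> (\<Sum>i\<in>{1..n}. L * \<eta> t)" by (intro sum_norm_le d)
  finally have "real n * norm ?D \<le> real n * (L * \<eta> t)" by simp
  then have "norm ?D \<le> L * \<eta> t" using n_pos by simp
  then have "norm (?d i - ?D) \<le> 2 * L * \<eta> t"
    using d[OF i] norm_triangle_ineq4[of "?d i" ?D] by linarith
  then have "norm (?d i - ?D) / real q \<le> 2 * L * \<eta> t / real q"
    by (rule divide_right_mono) simp
  then show ?thesis by (simp add: centred_def)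
qed

lemma err_adapted: "depends_below (Suc t) (err t)"
proof -
  have "grad_est V n h q q (\<lambda>s. proj (\<omega> s)) (\<lambda>s. x s \<omega>) t
      = grad_est V n h q q (\<lambda>s. proj (\<omega>' s)) (\<lambda>s. x s \<omega>') t"
    if "\<forall>s<Suc t. \<omega> s = \<omega>' s" for \<omega> \<omega>'
    using that
  proof (induction t)
    case 0
    have "x 0 \<omega> = x 0 \<omega>'" by (rule depends_belowD[OF x_adapted]) simp
    then show ?case by simp
  next
    case (Suc t)
    have "x (Suc t) \<omega> = x (Suc t) \<omega>'"
      by (rule depends_belowD[OF x_adapted]) (use Suc.prems in simp)
    moreover have "x t \<omega> = x t \<omega>'"
      by (rule depends_belowD[OF x_adapted]) (use Suc.prems in simp)
    moreover have "\<omega> (Suc t) = \<omega>' (Suc t)" using Suc.prems by blast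
    ultimately show ?case using Suc by simp
  qed
  moreover have "x t \<omega> = x t \<omega>'" if "\<forall>s<Suc t. \<omega> s = \<omega>' s" for \<omega> \<omega>'
    by (rule depends_belowD[OF x_adapted]) (use that in simp)
  ultimately show ?thesis unfolding depends_below_def err_def by metis
qed

lemma measurable_err: "(\<lambda>\<omega>. H (err t \<omega>) :: ennreal) \<in> borel_measurable M"
  by (rule measurable_depends_below[OF depends_below_comp[OF err_adapted]]) simp

text \<open>
  Along an epoch that starts at \<open>k\<close>, every iteration adds a batch of \<open>q\<close> centred vectors of norm at
  most \<open>b\<close>, whose values are determined by the past apart from the drawn indices.
\<close>

lemma exp_moment_err:
  assumes k: "q dvd k" and \<Lambda>: "\<Lambda> > 0" and j: "j < q"
    and b: "\<And>r. k \<le> r \<Longrightarrow> r < k + j \<Longrightarrow> 2 * L * \<eta> r / real q \<le> b"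
  shows "(\<integral>\<^sup>+\<omega>. ennreal (exp ((norm (err (k + j) \<omega>))\<^sup>2 / (\<Lambda> + real (j * q) * (2 * b\<^sup>2)))) \<partial>M)
         \<le> ennreal (exp (real (j * q) * b\<^sup>2 / \<Lambda>))"
  using j b
proof (induction j)
  case 0
  interpret prob_space M by (rule prob_space_sample_measure)
  show ?case using emeasure_space_1 by (simp add: err_restart[OF k])
next
  case (Suc j)
  let ?t = "k + j"
  let ?\<Lambda>' = "\<Lambda> + real (j * q) * (2 * b\<^sup>2)"
  have \<Lambda>': "?\<Lambda>' \<ge> \<Lambda>" "?\<Lambda>' > 0" using \<Lambda> by (auto simp: add_pos_nonneg)
  have nd: "\<not> q dvd Suc ?t"
  proof
    assume "q dvd Suc ?t"
    then have "q dvd Suc j" using k by (metis add_Suc_right dvd_add_right_iff)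
    then show False using Suc.prems(1) by (auto dest: dvd_imp_le)
  qed
  let ?f = "\<lambda>y. ennreal (exp ((norm y)\<^sup>2 / (?\<Lambda>' + real q * (2 * b\<^sup>2))))"
  have upd: "err (Suc ?t) (fun_upd \<omega> (Suc ?t) \<beta>) = err ?t \<omega> + (\<Sum>i<q. centred ?t \<omega> (proj \<beta> ! i))" for \<omega> \<beta>
  proof -
    let ?\<omega>' = "fun_upd \<omega> (Suc ?t) \<beta>"
    have "x (Suc ?t) ?\<omega>' = x (Suc ?t) \<omega>" by (rule depends_belowD[OF x_adapted]) simp
    moreover have "x ?t ?\<omega>' = x ?t \<omega>" by (rule depends_belowD[OF x_adapted]) simp
    moreover have "err ?t ?\<omega>' = err ?t \<omega>" by (rule depends_belowD[OF err_adapted]) simp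
    ultimately show ?thesis by (simp add: err_Suc[OF nd] centred_def)
  qed
  have "(\<integral>\<^sup>+\<omega>. ?f (err (Suc ?t) \<omega>) \<partial>M)
      = (\<integral>\<^sup>+\<omega>. (\<integral>\<^sup>+\<beta>. ?f (err (Suc ?t) (fun_upd \<omega> (Suc ?t) \<beta>)) \<partial>B (Suc ?t)) \<partial>M)"
    by (rule nn_integral_resample[OF measurable_err])
  also have "\<dots> = (\<integral>\<^sup>+\<omega>. (\<integral>\<^sup>+l. ?f (err ?t \<omega> + (\<Sum>i<q. centred ?t \<omega> (l ! i)))
      \<partial>map_pmf proj (B (Suc ?t))) \<partial>M)"
    by (simp only: upd nn_integral_map_pmf)
  also have "\<dots> \<le> (\<integral>\<^sup>+\<omega>. ennreal (exp (real q * b\<^sup>2 / ?\<Lambda>')) *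
      ennreal (exp ((norm (err ?t \<omega>))\<^sup>2 / ?\<Lambda>')) \<partial>M)"
  proof (rule nn_integral_mono)
    fix \<omega>
    have "norm (centred ?t \<omega> i) \<le> b" if "i \<in> {1..n}" for i
      using norm_centred[OF that, of ?t \<omega>] Suc.prems(2)[of ?t] by simp
    then show "(\<integral>\<^sup>+l. ?f (err ?t \<omega> + (\<Sum>i<q. centred ?t \<omega> (l ! i))) \<partial>map_pmf proj (B (Suc ?t)))
        \<le> ennreal (exp (real q * b\<^sup>2 / ?\<Lambda>')) * ennreal (exp ((norm (err ?t \<omega>))\<^sup>2 / ?\<Lambda>'))"
      unfolding batch_law ennreal_mult[symmetric, OF exp_ge_zero exp_ge_zero]
      using n_pos \<Lambda>' sum_centred by (intro exp_square_norm_batch) auto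
  qed
  also have "\<dots> = ennreal (exp (real q * b\<^sup>2 / ?\<Lambda>')) *
      (\<integral>\<^sup>+\<omega>. ennreal (exp ((norm (err ?t \<omega>))\<^sup>2 / ?\<Lambda>')) \<partial>M)"
    by (rule nn_integral_cmult[OF measurable_err])
  also have "\<dots> \<le> ennreal (exp (real q * b\<^sup>2 / \<Lambda>)) * ennreal (exp (real (j * q) * b\<^sup>2 / \<Lambda>))"
    using Suc.prems Suc.IH \<Lambda> \<Lambda>'
    by (intro mult_mono ennreal_leI) (auto intro!: divide_left_mono mult_pos_pos)
  also have "\<dots> = ennreal (exp (real (Suc j * q) * b\<^sup>2 / \<Lambda>))"
    by (simp add: ennreal_mult[symmetric] exp_add[symmetric] algebra_simps add_divide_distrib)
  finally show ?case by (simp add: algebra_simps)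
qed

text \<open>
  An epoch draws at most \<open>q * q\<close> samples, each of size \<open>K / q\<close>, so the total variance is at most
  \<open>K ^ 2\<close>, independently of \<open>q\<close>.  This is the reason for the batch size \<open>S = q\<close>.  The tail is Markov's
  inequality for \<open>exp (norm err ^ 2 / (4 K ^ 2))\<close>.
\<close>

lemma err_tail:
  assumes K: "K > 0" and \<eta>: "\<And>r. q * (t div q) \<le> r \<Longrightarrow> r < t \<Longrightarrow> 2 * L * \<eta> r \<le> K"
    and \<delta>: "0 < \<delta>" "\<delta> < 1"
  shows "{\<omega>. norm (err t \<omega>) > 2 * K * sqrt (ln (2 / \<delta>))} \<in> sets M"
    and "measure M {\<omega>. norm (err t \<omega>) > 2 * K * sqrt (ln (2 / \<delta>))} \<le> \<delta>"
proof -
  interpret prob_space M by (rule prob_space_sample_measure)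
  let ?bad = "{\<omega>. norm (err t \<omega>) > 2 * K * sqrt (ln (2 / \<delta>))}"
  show bad: "?bad \<in> sets M"
    by (rule sets_depends_below[OF depends_below_comp[OF err_adapted]])
  define k where "k = q * (t div q)"
  define j where "j = t mod q"
  have t: "t = k + j" and j: "j < q" using q_pos by (auto simp: k_def j_def)
  define b where "b = K / real q"
  have N: "real (j * q) * b\<^sup>2 \<le> K\<^sup>2"
  proof -
    have "real (j * q) * b\<^sup>2 \<le> real (q * q) * b\<^sup>2"
      using j by (intro mult_right_mono) auto
    also have "\<dots> = K\<^sup>2" using q_pos by (simp add: b_def power2_eq_square)
    finally show ?thesis .
  qed
  have "(\<integral>\<^sup>+\<omega>. ennreal (exp ((norm (err t \<omega>))\<^sup>2 / (4 * K\<^sup>2))) \<partial>M)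
      \<le> (\<integral>\<^sup>+\<omega>. ennreal (exp ((norm (err (k + j) \<omega>))\<^sup>2 / (2 * K\<^sup>2 + real (j * q) * (2 * b\<^sup>2)))) \<partial>M)"
  proof (intro nn_integral_mono ennreal_leI)
    fix \<omega>
    have "2 * K\<^sup>2 + real (j * q) * (2 * b\<^sup>2) \<le> 4 * K\<^sup>2" using N by linarith
    moreover have "0 < 2 * K\<^sup>2 + real (j * q) * (2 * b\<^sup>2)"
      using K by (intro add_pos_nonneg) simp_all
    ultimately show "exp ((norm (err t \<omega>))\<^sup>2 / (4 * K\<^sup>2))
        \<le> exp ((norm (err (k + j) \<omega>))\<^sup>2 / (2 * K\<^sup>2 + real (j * q) * (2 * b\<^sup>2)))"
      unfolding t exp_le_cancel_iff using K by (intro divide_left_mono mult_pos_pos) auto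
  qed
  also have "\<dots> \<le> ennreal (exp (real (j * q) * b\<^sup>2 / (2 * K\<^sup>2)))"
  proof (rule exp_moment_err)
    show "q dvd k" "0 < 2 * K\<^sup>2" "j < q" using K j by (simp_all add: k_def)
    fix r assume "k \<le> r" "r < k + j"
    then have "2 * L * \<eta> r \<le> K" using \<eta>[of r] by (simp add: k_def[symmetric] t[symmetric])
    then show "2 * L * \<eta> r / real q \<le> b" unfolding b_def by (rule divide_right_mono) simp
  qed
  also have "\<dots> \<le> ennreal 2"
  proof (rule ennreal_leI)
    have "real (j * q) * b\<^sup>2 / (2 * K\<^sup>2) \<le> 1 / 2" using N K by (simp add: field_simps)
    then have "exp (real (j * q) * b\<^sup>2 / (2 * K\<^sup>2)) \<le> exp (1 / 2)" by simp
    also have "\<dots> \<le> (2::real)" using exp_bound[of "1/2"] by (simp add: power2_eq_square)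
    finally show "exp (real (j * q) * b\<^sup>2 / (2 * K\<^sup>2)) \<le> 2" .
  qed
  finally have moment: "(\<integral>\<^sup>+\<omega>. ennreal (exp ((norm (err t \<omega>))\<^sup>2 / (4 * K\<^sup>2))) \<partial>M) \<le> ennreal 2" .
  have "ennreal (2 / \<delta>) * emeasure M ?bad = (\<integral>\<^sup>+\<omega>. ennreal (2 / \<delta>) * indicator ?bad \<omega> \<partial>M)"
    using bad by (simp add: nn_integral_cmult_indicator)
  \<comment> \<open>On the bad event the integrand exceeds \<open>2 / \<delta>\<close>.\<close>
  also have "\<dots> \<le> (\<integral>\<^sup>+\<omega>. ennreal (exp ((norm (err t \<omega>))\<^sup>2 / (4 * K\<^sup>2))) \<partial>M)"
  proof (rule nn_integral_mono)
    fix \<omega>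
    show "ennreal (2 / \<delta>) * indicator ?bad \<omega> \<le> ennreal (exp ((norm (err t \<omega>))\<^sup>2 / (4 * K\<^sup>2)))"
    proof (cases "\<omega> \<in> ?bad")
      case True
      have ln: "ln (2 / \<delta>) \<ge> 0" using \<delta> by simp
      have "(2 * K * sqrt (ln (2 / \<delta>)))\<^sup>2 \<le> (norm (err t \<omega>))\<^sup>2"
        using True K ln by (intro power_mono) auto
      then have "ln (2 / \<delta>) \<le> (norm (err t \<omega>))\<^sup>2 / (4 * K\<^sup>2)"
        using K ln by (simp add: power_mult_distrib field_simps)
      then have "exp (ln (2 / \<delta>)) \<le> exp ((norm (err t \<omega>))\<^sup>2 / (4 * K\<^sup>2))" by simp
      then have "2 / \<delta> \<le> exp ((norm (err t \<omega>))\<^sup>2 / (4 * K\<^sup>2))" using \<delta> by simp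
      then show ?thesis using True by (simp add: ennreal_leI)
    qed simp
  qed
  also note moment
  finally have "ennreal (2 / \<delta>) * ennreal (measure M ?bad) \<le> ennreal 2"
    by (simp only: emeasure_eq_measure)
  moreover have "ennreal (2 / \<delta> * measure M ?bad) = ennreal (2 / \<delta>) * ennreal (measure M ?bad)"
    using \<delta> by (intro ennreal_mult) auto
  ultimately have "2 / \<delta> * measure M ?bad \<le> 2"
    by (metis ennreal_le_iff zero_le_numeral)
  then show "measure M ?bad \<le> \<delta>" using \<delta> by (simp add: field_simps)
qed

end

section \<open>Gradients on a convex set and one conditional gradient step\<close>

lemma has_gradient_grad:
  assumes "subspace V" "X \<subseteq> V" "C1_near V X h" "x \<in> X"
  shows "has_gradient V h x (grad V h x)"
proof -
  obtain u where "has_gradient V h x u"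
    using assms(3,4) unfolding C1_near_def by blast
  then have "\<exists>!u. has_gradient V h x u"
    using has_gradient_unique[OF assms(1)] assms(2,4) by blast
  then show ?thesis unfolding grad_def by (rule theI')
qed

lemma C1_near_imp_continuous_on:
  assumes "subspace V" "X \<subseteq> V" "C1_near V X h"
  shows "continuous_on X h"
proof -
  have "continuous (at x within X) h" if "x \<in> X" for x
    using has_gradient_grad[OF assms that] assms(2)
    by (auto simp: has_gradient_def intro: has_derivative_continuous has_derivative_subset)
  then show ?thesis by (simp add: continuous_on_eq_continuous_within)
qed

lemma grad_avg:
  assumes V: "subspace V" "X \<subseteq> V" and h: "\<And>i. i \<in> {1..n} \<Longrightarrow> C1_near V X (h i)"
    and n: "0 < n" and x: "x \<in> X"
  shows "real n *\<^sub>R grad V (avg n h) x = (\<Sum>i\<in>{1..n}. grad V (h i) x)"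
proof -
  let ?u = "(1 / real n) *\<^sub>R (\<Sum>i\<in>{1..n}. grad V (h i) x)"
  have g: "has_gradient V (h i) x (grad V (h i) x)" if "i \<in> {1..n}" for i
    using has_gradient_grad[OF V h[OF that] x] .
  have "((\<lambda>y. (1 / real n) * (\<Sum>i\<in>{1..n}. h i y)) has_derivative
      (\<lambda>w. (1 / real n) * (\<Sum>i\<in>{1..n}. grad V (h i) x \<bullet> w))) (at x within V)"
    using g by (intro has_derivative_mult_right has_derivative_sum) (auto simp: has_gradient_def)
  moreover have "?u \<in> V"
    using g V(1) by (intro subspace_scale subspace_sum) (auto simp: has_gradient_def)
  ultimately have u: "has_gradient V (avg n h) x ?u"
    by (simp add: has_gradient_def avg_def[abs_def] inner_sum_left)
  then have "\<exists>!u. has_gradient V (avg n h) x u"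
    using has_gradient_unique[OF V(1)] V(2) x by blast
  then have "grad V (avg n h) x = ?u"
    using the1_equality[of "has_gradient V (avg n h) x"] u unfolding grad_def by blast
  then show ?thesis using n by simp
qed

lemma gradient_along_segment:
  assumes V: "subspace V" "x \<in> V" "w \<in> V" and g: "has_gradient V h (x + t *\<^sub>R w) u"
  shows "((\<lambda>s. h (x + s *\<^sub>R w)) has_real_derivative u \<bullet> w) (at t)"
proof -
  let ?l = "\<lambda>s::real. x + s *\<^sub>R w"
  have l: "(?l has_derivative (\<lambda>s. s *\<^sub>R w)) (at t)"
    by (auto intro!: derivative_eq_intros)
  have "range ?l \<subseteq> V" using V by (auto intro: subspace_add subspace_scale)
  then have "(h has_derivative (\<lambda>w. u \<bullet> w)) (at (?l t) within range ?l)"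
    using g by (auto simp: has_gradient_def intro: has_derivative_subset)
  from has_derivative_in_compose[OF l this] show ?thesis
    by (simp add: has_field_derivative_def mult.commute[of _ "u \<bullet> w"])
qed

lemma convex_above_gradient:
  assumes V: "subspace V" "X \<subseteq> V" and h: "convex_on X h" and xy: "x \<in> X" "y \<in> X"
    and g: "has_gradient V h x u"
  shows "h x + u \<bullet> (y - x) \<le> h y"
proof -
  have w: "y - x \<in> V" and x: "x \<in> V" using V xy by (auto intro: subspace_diff)
  have "((\<lambda>s. h (x + s *\<^sub>R (y - x))) has_real_derivative u \<bullet> (y - x)) (at 0)"
    using g by (intro gradient_along_segment[OF V(1) x w]) simp
  then have "((\<lambda>s. (h (x + s *\<^sub>R (y - x)) - h x) / s) \<longlongrightarrow> u \<bullet> (y - x)) (at_right 0)"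
    by (auto simp: DERIV_def intro: filterlim_mono at_within_le_nhds at_le)
  moreover have "\<forall>\<^sub>F s in at_right (0::real). (h (x + s *\<^sub>R (y - x)) - h x) / s \<le> h y - h x"
  proof -
    have "(h (x + s *\<^sub>R (y - x)) - h x) / s \<le> h y - h x" if s: "0 < s" "s < 1" for s
    proof -
      have "h ((1 - s) *\<^sub>R x + s *\<^sub>R y) \<le> (1 - s) * h x + s * h y"
        using h xy s by (intro convex_onD) auto
      moreover have "(1 - s) *\<^sub>R x + s *\<^sub>R y = x + s *\<^sub>R (y - x)" by (simp add: algebra_simps)
      ultimately have "h (x + s *\<^sub>R (y - x)) - h x \<le> s * (h y - h x)"
        by (simp add: algebra_simps)
      then show ?thesis using s by (simp add: field_simps)
    qed
    then show ?thesis
      using eventually_at_right_real[of 0 "1::real"] by (auto elim: eventually_mono)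
  qed
  ultimately have "u \<bullet> (y - x) \<le> h y - h x"
    by (intro tendsto_upperbound[of _ _ "at_right (0::real)"]) auto
  then show ?thesis by simp
qed

lemma smooth_below_quadratic:
  assumes V: "subspace V" "X \<subseteq> V" and X: "convex X" and xy: "x \<in> X" "y \<in> X"
    and g: "\<And>z. z \<in> X \<Longrightarrow> has_gradient V h z (u z)"
    and lip: "\<And>z. z \<in> X \<Longrightarrow> norm (u z - u x) \<le> L * norm (z - x)"
  shows "h y \<le> h x + u x \<bullet> (y - x) + L / 2 * (norm (y - x))\<^sup>2"
proof -
  let ?w = "y - x"
  have w: "?w \<in> V" and xV: "x \<in> V" using V xy by (auto intro: subspace_diff)
  define \<psi> where "\<psi> s = h (x + s *\<^sub>R ?w) - s * (u x \<bullet> ?w) - L / 2 * s\<^sup>2 * (norm ?w)\<^sup>2" for s :: real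
  have "\<psi> 1 \<le> \<psi> 0"
  proof (rule DERIV_nonpos_imp_nonincreasing[of 0 1 \<psi>])
    fix s :: real assume s: "0 \<le> s" "s \<le> 1"
    let ?z = "x + s *\<^sub>R ?w"
    have z: "?z \<in> X"
    proof -
      have "(1 - s) *\<^sub>R x + s *\<^sub>R y \<in> X" using X xy s by (intro convexD) auto
      then show ?thesis by (simp add: algebra_simps)
    qed
    have "(\<psi> has_real_derivative (u ?z \<bullet> ?w - u x \<bullet> ?w - L * s * (norm ?w)\<^sup>2)) (at s)"
      unfolding \<psi>_def
      by (auto intro!: derivative_eq_intros gradient_along_segment[OF V(1) xV w g[OF z]])
    moreover have "u ?z \<bullet> ?w - u x \<bullet> ?w \<le> L * s * (norm ?w)\<^sup>2"
    proof -
      have "(u ?z - u x) \<bullet> ?w \<le> norm (u ?z - u x) * norm ?w" by (rule norm_cauchy_schwarz)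
      also have "\<dots> \<le> L * norm (?z - x) * norm ?w"
        by (intro mult_right_mono lip z) simp
      also have "\<dots> = L * s * (norm ?w)\<^sup>2" using s by (simp add: power2_eq_square)
      finally show ?thesis by (simp add: inner_diff_left)
    qed
    ultimately show "\<exists>y. (\<psi> has_real_derivative y) (at s) \<and> y \<le> 0" by fastforce
  qed simp
  then show ?thesis by (simp add: \<psi>_def)
qed

text \<open>
  The linear minimisation oracle sees the estimates \<open>eF\<close>, \<open>eG\<close> in place of the gradients \<open>uF\<close>, \<open>uG\<close>.
  Comparing \<open>v\<close> with \<open>xs\<close> for the estimates and returning to the gradients at both points
  costs the error paired with \<open>xs - v\<close>, hence at most \<open>D\<close> times its norm.  The reference point \<open>xs\<close>
  will be a bilevel solution, the same one for every \<open>\<sigma>\<close>; it need not minimise \<open>\<sigma> F + G\<close>, so both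
  sides may be negative.
\<close>

lemma inexact_conditional_gradient_step:
  fixes x x' v xs :: "'b::real_inner"
  assumes \<alpha>: "0 \<le> \<alpha>" and \<sigma>: "0 \<le> \<sigma>" and LF: "0 \<le> LF" and LG: "0 \<le> LG"
    and x': "x' = x + \<alpha> *\<^sub>R (v - x)" and D: "norm (v - x) \<le> D" "norm (xs - v) \<le> D"
    and smooth: "F x' \<le> F x + uF \<bullet> (x' - x) + LF / 2 * (norm (x' - x))\<^sup>2"
      "G x' \<le> G x + uG \<bullet> (x' - x) + LG / 2 * (norm (x' - x))\<^sup>2"
    and cvx: "F x + uF \<bullet> (xs - x) \<le> F xs" "G x + uG \<bullet> (xs - x) \<le> G xs"
    and lmo: "(\<sigma> *\<^sub>R eF + eG) \<bullet> v \<le> (\<sigma> *\<^sub>R eF + eG) \<bullet> xs"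
  shows "\<sigma> * (F x' - F xs) + (G x' - G xs) \<le> (1 - \<alpha>) * (\<sigma> * (F x - F xs) + (G x - G xs))
    + \<alpha> * (D * (\<sigma> * norm (eF - uF) + norm (eG - uG))) + \<alpha>\<^sup>2 * ((\<sigma> * LF + LG) * D\<^sup>2 / 2)"
proof -
  let ?d = "\<sigma> *\<^sub>R (eF - uF) + (eG - uG)" and ?u = "\<sigma> *\<^sub>R uF + uG"
  have "norm ?d \<le> \<sigma> * norm (eF - uF) + norm (eG - uG)"
    using norm_triangle_ineq[of "\<sigma> *\<^sub>R (eF - uF)" "eG - uG"] \<sigma> by simp
  moreover have "?d \<bullet> (xs - v) \<le> norm ?d * D"
    using norm_cauchy_schwarz[of ?d "xs - v"] mult_left_mono[OF D(2), of "norm ?d"] by simp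
  moreover have D0: "0 \<le> D" using D(1) norm_ge_zero order_trans by blast
  ultimately have dev: "?d \<bullet> (xs - v) \<le> D * (\<sigma> * norm (eF - uF) + norm (eG - uG))"
    using mult_right_mono[of "norm ?d" "\<sigma> * norm (eF - uF) + norm (eG - uG)" D]
    by (simp add: mult.commute)
  have "?u \<bullet> (v - x) = ?u \<bullet> (xs - x) + ?d \<bullet> (xs - v)
      + ((\<sigma> *\<^sub>R eF + eG) \<bullet> v - (\<sigma> *\<^sub>R eF + eG) \<bullet> xs)"
    by (simp add: inner_simps algebra_simps)
  also have "\<dots> \<le> ?u \<bullet> (xs - x) + D * (\<sigma> * norm (eF - uF) + norm (eG - uG))"
    using dev lmo by simp
  also have "?u \<bullet> (xs - x) = \<sigma> * (uF \<bullet> (xs - x)) + uG \<bullet> (xs - x)"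
    by (simp add: inner_simps algebra_simps)
  also have "\<dots> \<le> \<sigma> * (F xs - F x) + (G xs - G x)"
    using cvx \<sigma> by (intro add_mono mult_left_mono) auto
  finally have lin: "\<alpha> * (?u \<bullet> (v - x)) \<le> \<alpha> * (\<sigma> * (F xs - F x) + (G xs - G x)
      + D * (\<sigma> * norm (eF - uF) + norm (eG - uG)))"
    using \<alpha> by (intro mult_left_mono) auto
  have "(norm (x' - x))\<^sup>2 \<le> \<alpha>\<^sup>2 * D\<^sup>2"
    using D(1) by (simp add: x' power_mult_distrib mult_left_mono power_mono)
  then have quad: "(\<sigma> * LF + LG) / 2 * (norm (x' - x))\<^sup>2 \<le> (\<sigma> * LF + LG) / 2 * (\<alpha>\<^sup>2 * D\<^sup>2)"
    using \<sigma> LF LG by (intro mult_left_mono) auto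
  have "\<sigma> * F x' + G x' \<le> \<sigma> * (F x + uF \<bullet> (x' - x) + LF / 2 * (norm (x' - x))\<^sup>2)
      + (G x + uG \<bullet> (x' - x) + LG / 2 * (norm (x' - x))\<^sup>2)"
    using smooth \<sigma> by (intro add_mono mult_left_mono) auto
  also have "\<dots> = \<sigma> * F x + G x + \<alpha> * (?u \<bullet> (v - x)) + (\<sigma> * LF + LG) / 2 * (norm (x' - x))\<^sup>2"
    by (simp add: x' inner_simps algebra_simps add_divide_distrib)
  finally have "\<sigma> * F x' + G x' \<le> \<sigma> * F x + G x
      + \<alpha> * (\<sigma> * (F xs - F x) + (G xs - G x) + D * (\<sigma> * norm (eF - uF) + norm (eG - uG)))
      + (\<sigma> * LF + LG) / 2 * (\<alpha>\<^sup>2 * D\<^sup>2)"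
    using lin quad by linarith
  then show ?thesis by (simp add: algebra_simps add_divide_distrib)
qed

section \<open>Weighted descent inequality\<close>

text \<open>
  The confidence factor of a union bound over time: a Gaussian quantile at level of order \<open>\<delta> / t ^ 2\<close>.
\<close>

definition conf :: "real \<Rightarrow> nat \<Rightarrow> real"
  where "conf \<delta> t = sqrt (ln (16 * (real t)\<^sup>2 / \<delta>))"

lemma conf_ge_1:
  assumes "0 < \<delta>" "\<delta> < 1" "1 \<le> t"
  shows "1 \<le> conf \<delta> t"
proof -
  have "exp 1 \<le> (16::real)" using exp_le by simp
  also have "\<dots> \<le> 16 * (real t)\<^sup>2" using assms by simp
  also have "\<dots> \<le> 16 * (real t)\<^sup>2 / \<delta>" using assms by (simp add: field_simps mult_left_le)
  finally have "1 \<le> ln (16 * (real t)\<^sup>2 / \<delta>)"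
    using assms by (simp add: ln_ge_iff)
  then show ?thesis by (simp add: conf_def)
qed

lemma conf_mono:
  assumes "0 < \<delta>" "1 \<le> s" "s \<le> t"
  shows "conf \<delta> s \<le> conf \<delta> t"
proof -
  have "16 * (real s)\<^sup>2 / \<delta> \<le> 16 * (real t)\<^sup>2 / \<delta>"
    using assms by (intro divide_right_mono mult_left_mono power_mono) auto
  then show ?thesis using assms by (simp add: conf_def)
qed

text \<open>
  An upper bound for the step sizes used since the last restart before \<open>t\<close>.  The summand \<open>1\<close> keeps it
  positive for \<open>q = 1\<close>; for \<open>q \<le> t\<close> the epoch began after \<open>t / 2\<close>, whence the factor \<open>4\<close> instead of \<open>2\<close>.
\<close>

definition epoch_rate :: "nat \<Rightarrow> nat \<Rightarrow> real"
  where "epoch_rate q t = (if t < q then (1 + ln (real q)) / real q else 4 / (real t + 1))"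

lemma c_fac_bounds:
  assumes "1 \<le> q" "q \<le> t"
  shows "1 \<le> c_fac t q" "real q * (1 + ln (real q)) \<le> 2 * c_fac t q * real t"
    "c_fac t q \<le> 1 + ln (real t)"
proof -
  show c1: "1 \<le> c_fac t q" by (simp add: c_fac_def)
  have "real q * ln (real q) / real t * real t \<le> c_fac t q * real t"
    by (intro mult_right_mono) (auto simp: c_fac_def)
  then have "real q * ln (real q) \<le> c_fac t q * real t" using assms by simp
  moreover have "real q \<le> c_fac t q * real t"
    using assms order_trans[OF _ mult_right_mono[OF c1, of "real t"], of "real q"] by simp
  ultimately show "real q * (1 + ln (real q)) \<le> 2 * c_fac t q * real t"
    by (simp add: algebra_simps)
  have "real q * ln (real q) \<le> real t * ln (real t)"
    using assms by (intro mult_mono) auto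
  then have "real q * ln (real q) / real t \<le> ln (real t)"
    using assms by (simp add: field_simps)
  moreover have "0 \<le> ln (real t)" using assms by simp
  ultimately show "c_fac t q \<le> 1 + ln (real t)" by (simp add: c_fac_def)
qed

lemma step_alpha_bounds:
  assumes "1 \<le> q"
  shows "0 \<le> step_alpha q t" "step_alpha q t \<le> 1"
proof -
  have "ln (real q) \<le> real q" using assms ln_le_minus_one[of "real q"] by simp
  then show "step_alpha q t \<le> 1" using assms by (simp add: step_alpha_def)
  show "0 \<le> step_alpha q t" using assms by (simp add: step_alpha_def)
qed

text \<open>
  During the first \<open>q\<close> iterations the step size \<open>ln q / q\<close> is constant, and the initial gap is reduced by
  \<open>(1 - ln q / q) ^ q \<le> 1 / q\<close>, which is also the order of the noise up to a logarithm.
\<close>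

lemma warm_up:
  fixes u :: "nat \<Rightarrow> real"
  assumes q: "1 \<le> q" and \<delta>: "0 < \<delta>" "\<delta> < 1" and A: "0 \<le> A" and U: "u 0 \<le> U" "0 \<le> U"
    and step: "\<And>t. t < q \<Longrightarrow> u (Suc t) \<le> (1 - step_alpha q t) * u t
      + A * (2 * step_alpha q t * epoch_rate q t * conf \<delta> (Suc t) + (step_alpha q t)\<^sup>2 / 2)"
  shows "u q \<le> (1 + ln (real q)) / real q * conf \<delta> q * (U + 3 * A)"
proof -
  define \<alpha> where "\<alpha> = ln (real q) / real q"
  define \<gamma> where "\<gamma> = (1 + ln (real q)) / real q"
  define E where "E = 3 * A * \<gamma> * conf \<delta> q"
  have \<alpha>: "0 \<le> \<alpha>" "\<alpha> \<le> 1" using step_alpha_bounds[OF q, of 0] q by (auto simp: \<alpha>_def step_alpha_def)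
  have \<gamma>: "\<alpha> \<le> \<gamma>" "1 / real q \<le> \<gamma>" "0 \<le> \<gamma>"
    using q by (auto simp: \<alpha>_def \<gamma>_def intro!: divide_right_mono)
  have Q: "1 \<le> conf \<delta> q" using conf_ge_1 \<delta> q by blast
  have E: "0 \<le> E" using A \<gamma> Q by (simp add: E_def)
  have noise: "A * (2 * step_alpha q t * epoch_rate q t * conf \<delta> (Suc t) + (step_alpha q t)\<^sup>2 / 2) \<le> \<alpha> * E"
    if "t < q" for t
  proof -
    have "\<gamma> * conf \<delta> (Suc t) \<le> \<gamma> * conf \<delta> q"
      using that \<gamma> \<delta> by (intro mult_left_mono conf_mono) auto
    moreover have "\<alpha> \<le> \<gamma> * conf \<delta> q" using \<gamma> Q mult_mono[of \<alpha> \<gamma> 1 "conf \<delta> q"] by simp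
    ultimately have "2 * (\<gamma> * conf \<delta> (Suc t)) + \<alpha> / 2 \<le> 3 * (\<gamma> * conf \<delta> q)" using \<alpha> by linarith
    then have "\<alpha> * A * (2 * (\<gamma> * conf \<delta> (Suc t)) + \<alpha> / 2) \<le> \<alpha> * A * (3 * (\<gamma> * conf \<delta> q))"
      using \<alpha> A by (intro mult_left_mono) auto
    then show ?thesis
      using that by (simp add: step_alpha_def epoch_rate_def \<alpha>_def[symmetric] \<gamma>_def[symmetric] E_def
        power2_eq_square algebra_simps)
  qed
  have "u t \<le> (1 - \<alpha>) ^ t * U + E" if "t \<le> q" for t
    using that
  proof (induction t)
    case 0
    then show ?case using U E by simp
  next
    case (Suc t)
    have "u (Suc t) \<le> (1 - \<alpha>) * u t + \<alpha> * E"
      using step[of t] noise[of t] Suc.prems by (simp add: step_alpha_def \<alpha>_def)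
    also have "\<dots> \<le> (1 - \<alpha>) * ((1 - \<alpha>) ^ t * U + E) + \<alpha> * E"
      using Suc \<alpha> by (intro add_right_mono mult_left_mono) auto
    finally show ?case by (simp add: algebra_simps)
  qed
  then have "u q \<le> (1 - \<alpha>) ^ q * U + E" by simp
  also have "(1 - \<alpha>) ^ q * U \<le> \<gamma> * conf \<delta> q * U"
  proof -
    have "(1 - \<alpha>) ^ q \<le> exp (- \<alpha>) ^ q"
      using \<alpha> exp_ge_add_one_self[of "- \<alpha>"] by (intro power_mono) auto
    also have "\<dots> = exp (real q * - \<alpha>)" by (simp only: exp_of_nat_mult)
    also have "real q * - \<alpha> = - ln (real q)" using q by (simp add: \<alpha>_def)
    also have "exp (- ln (real q)) = 1 / real q" using q by (simp add: exp_minus inverse_eq_divide)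
    also have "\<dots> \<le> \<gamma> * conf \<delta> q" using \<gamma> Q mult_mono[of "1 / real q" \<gamma> 1 "conf \<delta> q"] by simp
    finally show ?thesis using U(2) by (rule mult_right_mono)
  qed
  finally show ?thesis by (simp add: E_def \<gamma>_def[symmetric] algebra_simps)
qed

text \<open>
  Since \<open>(T + 2) * (1 - 2 / (T + 2)) = T\<close>, multiplication by \<open>(T + 1) * (T + 2)\<close> turns the contraction into
  a telescoping sum, with noise of order \<open>conf \<delta> (T + 1)\<close> per step.  Replacing \<open>\<sigma> T\<close> by \<open>\<sigma> (T + 1)\<close> in front
  of \<open>a (T + 1)\<close> releases the term with weight \<open>(T + 2) * (T + 1) * (\<sigma> T - \<sigma> (T + 1))\<close>.  The factor
  \<open>c_fac\<close> enters only through the value left by the warm-up phase, of order \<open>q * (1 + ln q)\<close>.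
\<close>

lemma weighted_descent:
  fixes a b :: "nat \<Rightarrow> real"
  assumes \<zeta>: "0 < \<zeta>" and p: "0 < p" and q: "1 \<le> q" and \<delta>: "0 < \<delta>" "\<delta> < 1" and A: "0 \<le> A"
    and init: "a 0 \<le> g1" "0 \<le> g1" "b 0 \<le> g2" "0 \<le> g2"
    and step: "\<And>t. reg_sigma \<zeta> p q t * a (Suc t) + b (Suc t)
        \<le> (1 - step_alpha q t) * (reg_sigma \<zeta> p q t * a t + b t)
          + A * (2 * step_alpha q t * epoch_rate q t * conf \<delta> (Suc t) + (step_alpha q t)\<^sup>2 / 2)"
    and T: "q \<le> T"
  shows "real ((T + 1) * T) * reg_sigma \<zeta> p q T * a T
      + (\<Sum>i\<in>{q<..T}. real ((i + 1) * i) * (reg_sigma \<zeta> p q (i - 1) - reg_sigma \<zeta> p q i) * a i)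
      + real ((T + 1) * T) * b T
    \<le> (4 * (\<zeta> * g1 + g2) + 30 * A) * (c_fac T q * real T * conf \<delta> T)"
proof -
  let ?\<sigma> = "reg_sigma \<zeta> p q"
  define w where "w i = real ((i + 1) * i) * (?\<sigma> (i - 1) - ?\<sigma> i)" for i
  define lhs where "lhs T = real ((T + 1) * T) * (?\<sigma> T * a T + b T) + (\<Sum>i\<in>{q<..T}. w i * a i)" for T
  define U where "U = \<zeta> * g1 + g2"
  have U: "0 \<le> U" using \<zeta> init by (simp add: U_def)
  have cT: "1 \<le> c_fac T q" using c_fac_bounds q T by blast
  have QT: "1 \<le> conf \<delta> T" using conf_ge_1 \<delta> q T by auto
  have "lhs q \<le> 2 * (real q * (1 + ln (real q))) * conf \<delta> q * (U + 3 * A)"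
  proof -
    have \<sigma>q: "?\<sigma> t = ?\<sigma> q" if "t \<le> q" for t using that by (simp add: reg_sigma_def max_def)
    have "?\<sigma> q \<le> \<zeta>" "0 \<le> ?\<sigma> q"
      using \<zeta> p powr_mono[of "-p" 0 "real q + 1"] by (auto simp: reg_sigma_def mult_left_le)
    then have "?\<sigma> q * a 0 + b 0 \<le> U"
      using init mult_left_mono[of "a 0" g1 "?\<sigma> q"] mult_right_mono[of "?\<sigma> q" \<zeta> g1] unfolding U_def by linarith
    then have "?\<sigma> q * a q + b q \<le> (1 + ln (real q)) / real q * conf \<delta> q * (U + 3 * A)"
    proof (intro warm_up[OF q \<delta> A, of "\<lambda>t. ?\<sigma> q * a t + b t"])
      fix t assume "t < q"
      then show "?\<sigma> q * a (Suc t) + b (Suc t) \<le> (1 - step_alpha q t) * (?\<sigma> q * a t + b t)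
          + A * (2 * step_alpha q t * epoch_rate q t * conf \<delta> (Suc t) + (step_alpha q t)\<^sup>2 / 2)"
        using step[of t] \<sigma>q[of t] by simp
    qed (use U in auto)
    then have "real ((q + 1) * q) * (?\<sigma> q * a q + b q)
        \<le> real ((q + 1) * q) * ((1 + ln (real q)) / real q * conf \<delta> q * (U + 3 * A))"
      by (intro mult_left_mono) auto
    also have "\<dots> = real (q + 1) * ((1 + ln (real q)) * conf \<delta> q * (U + 3 * A))"
      using q by (simp add: field_simps)
    also have "\<dots> \<le> (2 * real q) * ((1 + ln (real q)) * conf \<delta> q * (U + 3 * A))"
      using q A U conf_ge_1[OF \<delta> q] by (intro mult_right_mono mult_nonneg_nonneg) auto
    finally show ?thesis by (simp add: lhs_def algebra_simps)
  qed
  also have "\<dots> \<le> 2 * (2 * c_fac T q * real T) * conf \<delta> T * (U + 3 * A)"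
  proof (rule mult_right_mono)
    show "2 * (real q * (1 + ln (real q))) * conf \<delta> q \<le> 2 * (2 * c_fac T q * real T) * conf \<delta> T"
    proof (rule mult_mono)
      show "2 * (real q * (1 + ln (real q))) \<le> 2 * (2 * c_fac T q * real T)"
        using c_fac_bounds(2)[OF q T] by linarith
    qed (use conf_mono[OF \<delta>(1) q T] cT conf_ge_1[OF \<delta> q] in auto)
    show "0 \<le> U + 3 * A" using U A by simp
  qed
  finally have start: "lhs q \<le> (4 * U + 12 * A) * (c_fac T q * real T * conf \<delta> T)"
    by (simp add: algebra_simps)
  have "lhs T \<le> lhs q + 18 * A * (real (T - q) * conf \<delta> T)"
    using T
  proof (induction T rule: dec_induct)
    case base
    then show ?case by simp
  next
    case (step T)
    define noise where "noise = A * (2 * step_alpha q T * epoch_rate q T * conf \<delta> (Suc T) + (step_alpha q T)\<^sup>2 / 2)"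
    have Q: "1 \<le> conf \<delta> (Suc T)" using conf_ge_1 \<delta> by simp
    have "{q<..Suc T} = insert (Suc T) {q<..T}" using step by auto
    then have "lhs (Suc T) = (\<Sum>i\<in>{q<..T}. w i * a i)
        + (real T + 2) * (real T + 1) * (?\<sigma> T * a (Suc T) + b (Suc T))"
      by (simp add: lhs_def w_def algebra_simps)
    also have "\<dots> \<le> (\<Sum>i\<in>{q<..T}. w i * a i)
        + (real T + 2) * (real T + 1) * ((1 - step_alpha q T) * (?\<sigma> T * a T + b T) + noise)"
      using assms(11)[of T] by (intro add_left_mono mult_left_mono) (auto simp: noise_def)
    also have "\<dots> = lhs T + (real T + 2) * (real T + 1) * noise"
    proof -
      have "(real T + 2) * (1 - step_alpha q T) = real T" using step by (simp add: step_alpha_def field_simps)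
      moreover have "(real T + 2) * (real T + 1) * ((1 - step_alpha q T) * (?\<sigma> T * a T + b T))
          = ((real T + 2) * (1 - step_alpha q T)) * (real T + 1) * (?\<sigma> T * a T + b T)"
        by (simp only: ac_simps)
      ultimately have "(real T + 2) * (real T + 1) * ((1 - step_alpha q T) * (?\<sigma> T * a T + b T))
          = real T * (real T + 1) * (?\<sigma> T * a T + b T)"
        by simp
      then show ?thesis
        unfolding distrib_left[of "(real T + 2) * (real T + 1)"]
        by (simp add: lhs_def algebra_simps)
    qed
    also have "(real T + 2) * (real T + 1) * noise \<le> 18 * A * conf \<delta> (Suc T)"
    proof -
      have "(real T + 2) * (real T + 1) * noise
          = A * (16 * conf \<delta> (Suc T) + 2 * (real T + 1) / (real T + 2))"
        using step by (simp add: noise_def step_alpha_def epoch_rate_def divide_simps power2_eq_square)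
      also have "\<dots> \<le> A * (16 * conf \<delta> (Suc T) + 2 * conf \<delta> (Suc T))"
      proof -
        have "2 * (real T + 1) / (real T + 2) \<le> 2" by (simp add: field_simps)
        then show ?thesis using A Q by (intro mult_left_mono add_left_mono) linarith+
      qed
      finally show ?thesis by (simp add: algebra_simps)
    qed
    also have "lhs T \<le> lhs q + 18 * A * (real (T - q) * conf \<delta> (Suc T))"
    proof -
      have "A * (real (T - q) * conf \<delta> T) \<le> A * (real (T - q) * conf \<delta> (Suc T))"
        using A \<delta> q step by (intro mult_left_mono conf_mono) auto
      then show ?thesis using step.IH by linarith
    qed
    finally show ?case using step by (simp add: Suc_diff_le algebra_simps)
  qed
  also have "real (T - q) * conf \<delta> T \<le> c_fac T q * real T * conf \<delta> T"
    using cT QT mult_right_mono[OF cT, of "real T"] by (intro mult_right_mono) auto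
  finally have "lhs T \<le> (4 * U + 12 * A) * (c_fac T q * real T * conf \<delta> T)
      + 18 * A * (c_fac T q * real T * conf \<delta> T)"
    using start A by (simp add: mult_left_mono)
  then show ?thesis by (simp add: lhs_def w_def U_def algebra_simps)
qed

section \<open>The averaging weights\<close>

definition late_weight :: "real \<Rightarrow> real \<Rightarrow> nat \<Rightarrow> nat \<Rightarrow> real"
  where "late_weight \<zeta> p q i = real ((i + 1) * i) * (reg_sigma \<zeta> p q (i - 1) - reg_sigma \<zeta> p q i)"

lemma late_weight_bounds:
  assumes "0 < \<zeta>" "0 < p" "p < 1" "1 \<le> q" "q < i"
  shows "0 \<le> late_weight \<zeta> p q i" "late_weight \<zeta> p q i \<le> \<zeta> * real i powr (1 - p)"
proof -
  have i: "1 < real i" using assms by simp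
  let ?r = "real i / (real i + 1)"
  have \<sigma>: "reg_sigma \<zeta> p q (i - 1) = \<zeta> * real i powr (- p)"
    "reg_sigma \<zeta> p q i = \<zeta> * (real i + 1) powr (- p)"
  proof -
    have "max (i - 1) q = i - 1" "real (i - 1) + 1 = real i" using assms by auto
    then show "reg_sigma \<zeta> p q (i - 1) = \<zeta> * real i powr (- p)" by (simp only: reg_sigma_def)
    have "max i q = i" using assms by simp
    then show "reg_sigma \<zeta> p q i = \<zeta> * (real i + 1) powr (- p)" by (simp only: reg_sigma_def)
  qed
  have "(real i + 1) powr (- p) \<le> real i powr (- p)"
    using assms i by (intro powr_mono2') auto
  then show "0 \<le> late_weight \<zeta> p q i"
    using assms unfolding late_weight_def \<sigma> by (simp add: mult_left_mono)
  \<comment> \<open>Since \<open>p < 1\<close>, the ratio of consecutive values of \<open>\<sigma>\<close> is at least \<open>i / (i + 1)\<close>.\<close>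
  have "?r powr 1 \<le> ?r powr p" using assms i by (intro powr_mono') auto
  then have "?r * real i powr (- p) \<le> ?r powr p * real i powr (- p)"
    using i by (intro mult_right_mono) auto
  also have "\<dots> = (real i + 1) powr (- p)"
    using i by (simp add: powr_divide powr_minus field_simps)
  finally have "real i powr (- p) - (real i + 1) powr (- p) \<le> real i powr (- p) - ?r * real i powr (- p)"
    by simp
  also have "\<dots> = real i powr (- p) / (real i + 1)" using i by (simp add: field_simps)
  finally have "late_weight \<zeta> p q i \<le> real ((i + 1) * i) * (\<zeta> * (real i powr (- p) / (real i + 1)))"
    using assms unfolding late_weight_def \<sigma> right_diff_distrib[symmetric]
    by (intro mult_left_mono) auto
  also have "\<dots> = \<zeta> * (real i powr 1 * real i powr (- p))"
    using i by (simp add: field_simps)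
  also have "\<dots> = \<zeta> * real i powr (1 - p)" by (simp only: powr_add[symmetric]) simp
  finally show "late_weight \<zeta> p q i \<le> \<zeta> * real i powr (1 - p)" .
qed

lemma last_weight_bounds:
  assumes "0 < \<zeta>" "0 < p" "p < 1" "1 \<le> q" "q \<le> T"
  shows "\<zeta> * (real T * real T powr (1 - p)) \<le> real ((T + 1) * T) * reg_sigma \<zeta> p q T"
    "real ((T + 1) * T) * reg_sigma \<zeta> p q T \<le> 2 * \<zeta> * (real T * real T powr (1 - p))"
proof -
  have T: "1 \<le> real T" using assms by simp
  have eq: "real ((T + 1) * T) * reg_sigma \<zeta> p q T = \<zeta> * (real T * (real T + 1) powr (1 - p))"
  proof -
    have "(real T + 1) powr (1 - p) = (real T + 1) powr 1 * (real T + 1) powr (- p)"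
      by (simp only: powr_add[symmetric]) simp
    then show ?thesis using assms by (simp add: reg_sigma_def max_absorb1 algebra_simps)
  qed
  have "real T powr (1 - p) \<le> (real T + 1) powr (1 - p)"
    using assms by (intro powr_mono2) auto
  then show "\<zeta> * (real T * real T powr (1 - p)) \<le> real ((T + 1) * T) * reg_sigma \<zeta> p q T"
    using assms unfolding eq by (intro mult_left_mono) auto
  have "(real T + 1) powr (1 - p) \<le> (2 * real T) powr (1 - p)"
    using assms T by (intro powr_mono2) auto
  also have "\<dots> = 2 powr (1 - p) * real T powr (1 - p)" by (rule powr_mult)
  also have "\<dots> \<le> 2 powr 1 * real T powr (1 - p)"
    using assms by (intro mult_right_mono powr_mono) auto
  finally have "\<zeta> * (real T * (real T + 1) powr (1 - p)) \<le> \<zeta> * (real T * (2 * real T powr (1 - p)))"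
    using assms by (intro mult_left_mono) auto
  then show "real ((T + 1) * T) * reg_sigma \<zeta> p q T \<le> 2 * \<zeta> * (real T * real T powr (1 - p))"
    unfolding eq by (simp add: algebra_simps)
qed

lemma S_weight_eq:
  "S_weight (reg_sigma \<zeta> p q) q T = real ((T + 1) * T) * reg_sigma \<zeta> p q T + (\<Sum>i\<in>{q<..T}. late_weight \<zeta> p q i)"
proof -
  have "{1..T} - {1..q} = {q<..T}" by auto
  then show ?thesis by (simp add: S_weight_def late_weight_def)
qed

lemma S_weight_bounds:
  assumes "0 < \<zeta>" "0 < p" "p < 1" "1 \<le> q" "q \<le> T"
  shows "\<zeta> * (real T * real T powr (1 - p)) \<le> S_weight (reg_sigma \<zeta> p q) q T"
    "S_weight (reg_sigma \<zeta> p q) q T \<le> 3 * \<zeta> * (real T * real T powr (1 - p))"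
proof -
  have "0 \<le> (\<Sum>i\<in>{q<..T}. late_weight \<zeta> p q i)"
    using assms by (intro sum_nonneg late_weight_bounds) auto
  then show "\<zeta> * (real T * real T powr (1 - p)) \<le> S_weight (reg_sigma \<zeta> p q) q T"
    using last_weight_bounds(1)[OF assms] by (simp add: S_weight_eq)
  have "(\<Sum>i\<in>{q<..T}. late_weight \<zeta> p q i) \<le> (\<Sum>i\<in>{q<..T}. \<zeta> * real T powr (1 - p))"
  proof (rule sum_mono)
    fix i assume i: "i \<in> {q<..T}"
    have "late_weight \<zeta> p q i \<le> \<zeta> * real i powr (1 - p)"
      using assms i by (intro late_weight_bounds) auto
    also have "\<dots> \<le> \<zeta> * real T powr (1 - p)"
      using assms i by (intro mult_left_mono powr_mono2) auto
    finally show "late_weight \<zeta> p q i \<le> \<zeta> * real T powr (1 - p)" .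
  qed
  also have "\<dots> = real (T - q) * (\<zeta> * real T powr (1 - p))" by simp
  also have "\<dots> \<le> real T * (\<zeta> * real T powr (1 - p))"
    using assms by (intro mult_right_mono) auto
  finally show "S_weight (reg_sigma \<zeta> p q) q T \<le> 3 * \<zeta> * (real T * real T powr (1 - p))"
    using last_weight_bounds(2)[OF assms] by (simp add: S_weight_eq algebra_simps)
qed

lemma convex_on_z_avg:
  fixes X :: "'b::real_vector set"
  assumes par: "0 < \<zeta>" "0 < p" "p < 1" "1 \<le> q" "q \<le> T"
    and H: "convex_on X H" and X: "convex X" and x: "\<And>i. x i \<in> X"
  shows "S_weight (reg_sigma \<zeta> p q) q T * (H (z_avg (reg_sigma \<zeta> p q) q x T) - level)
    \<le> real ((T + 1) * T) * reg_sigma \<zeta> p q T * (H (x T) - level)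
      + (\<Sum>i\<in>{q<..T}. late_weight \<zeta> p q i * (H (x i) - level))"
proof -
  let ?\<sigma> = "reg_sigma \<zeta> p q"
  let ?S = "S_weight ?\<sigma> q T"
  define c where "c i = (if i = T then real ((T + 1) * T) * ?\<sigma> T else 0)
      + (if q < i then late_weight \<zeta> p q i else 0)" for i
  have split_sum: "(\<Sum>i\<in>{q..T}. c i *\<^sub>R f i) = (real ((T + 1) * T) * ?\<sigma> T) *\<^sub>R f T
      + (\<Sum>i\<in>{q<..T}. late_weight \<zeta> p q i *\<^sub>R f i)" for f :: "nat \<Rightarrow> 'c::real_vector"
  proof -
    have "(\<Sum>i\<in>{q..T}. c i *\<^sub>R f i)
        = (\<Sum>i\<in>{q..T}. if i = T then (real ((T + 1) * T) * ?\<sigma> T) *\<^sub>R f i else 0)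
        + (\<Sum>i\<in>{q..T}. if q < i then late_weight \<zeta> p q i *\<^sub>R f i else 0)"
      unfolding sum.distrib[symmetric] by (intro sum.cong) (auto simp: c_def scaleR_add_left)
    also have "(\<Sum>i\<in>{q..T}. if q < i then late_weight \<zeta> p q i *\<^sub>R f i else 0)
        = (\<Sum>i\<in>{q<..T}. late_weight \<zeta> p q i *\<^sub>R f i)"
      by (rule sum.mono_neutral_cong_right) auto
    finally show ?thesis using par by simp
  qed
  have c_nonneg: "0 \<le> c i" if "i \<in> {q..T}" for i
    using par that late_weight_bounds(1)[of \<zeta> p q i]
    by (auto simp: c_def reg_sigma_def intro!: add_nonneg_nonneg)
  have c_sum: "sum c {q..T} = ?S"
    using split_sum[of "\<lambda>_. 1::real"] by (simp add: S_weight_eq)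
  have "0 < \<zeta> * (real T * real T powr (1 - p))" using par by simp
  then have S_pos: "0 < ?S" using S_weight_bounds(1)[OF par] by linarith
  have z: "z_avg ?\<sigma> q x T = (\<Sum>i\<in>{q..T}. (c i / ?S) *\<^sub>R x i)"
  proof -
    have "{1..T} - {1..q} = {q<..T}" by auto
    then have "z_avg ?\<sigma> q x T = (1 / ?S) *\<^sub>R (\<Sum>i\<in>{q..T}. c i *\<^sub>R x i)"
      by (simp add: split_sum z_avg_def late_weight_def)
    then show ?thesis by (simp add: scaleR_sum_right)
  qed
  have "H (\<Sum>i\<in>{q..T}. (c i / ?S) *\<^sub>R x i) \<le> (\<Sum>i\<in>{q..T}. (c i / ?S) * H (x i))"
  proof (rule convex_on_sum)
    show "finite {q..T}" "{q..T} \<noteq> {}" using par by auto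
    show "(\<Sum>i\<in>{q..T}. c i / ?S) = 1" using c_sum S_pos by (simp add: sum_divide_distrib[symmetric])
  qed (use H X x c_nonneg S_pos in auto)
  also have "\<dots> = (\<Sum>i\<in>{q..T}. c i * H (x i)) / ?S" by (simp add: sum_divide_distrib)
  finally have "?S * H (z_avg ?\<sigma> q x T) \<le> (\<Sum>i\<in>{q..T}. c i * H (x i))"
    using S_pos by (simp add: z field_simps)
  then have "?S * (H (z_avg ?\<sigma> q x T) - level) \<le> (\<Sum>i\<in>{q..T}. c i *\<^sub>R (H (x i) - level))"
    by (simp add: right_diff_distrib sum_subtractf c_sum[symmetric] sum_distrib_right[symmetric])
  then show ?thesis unfolding split_sum by simp
qed

text \<open>
  For \<open>a \<le> 1\<close> the summands are dominated by the increments of \<open>t powr a / a\<close>; for \<open>a > 1\<close> each of them is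
  at most the last one.
\<close>

lemma sum_powr_bound:
  assumes a: "0 < a"
  shows "(\<Sum>i\<in>{0<..T}. real i powr (a - 1)) \<le> (1 + 1 / a) * real T powr a"
proof (cases "a \<le> 1")
  case True
  have "a * (\<Sum>i\<in>{0<..T}. real i powr (a - 1)) \<le> real T powr a"
  proof (induction T)
    case (Suc T)
    have "a * real (Suc T) powr (a - 1) \<le> real (Suc T) powr a - real T powr a"
    proof (cases "T = 0")
      case True
      then show ?thesis using \<open>a \<le> 1\<close> a by simp
    next
      case False
      have "\<exists>\<xi>. real T < \<xi> \<and> \<xi> < real (Suc T) \<and>
          real (Suc T) powr a - real T powr a = (real (Suc T) - real T) * (a * \<xi> powr (a - 1))"
        using False by (intro MVT2) (auto intro!: derivative_eq_intros)
      then obtain \<xi> where \<xi>: "real T < \<xi>" "\<xi> < real (Suc T)"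
        and eq: "real (Suc T) powr a - real T powr a = a * \<xi> powr (a - 1)" by auto
      have "real (Suc T) powr (a - 1) \<le> \<xi> powr (a - 1)"
        using \<xi> False \<open>a \<le> 1\<close> by (intro powr_mono2') auto
      then show ?thesis unfolding eq using a by (intro mult_left_mono) auto
    qed
    moreover have "{0<..Suc T} = insert (Suc T) {0<..T}" by auto
    ultimately show ?case using Suc by (simp add: algebra_simps)
  qed simp
  then have "(\<Sum>i\<in>{0<..T}. real i powr (a - 1)) \<le> 1 / a * real T powr a" using a by (simp add: field_simps)
  also have "\<dots> \<le> (1 + 1 / a) * real T powr a" by (intro mult_right_mono) auto
  finally show ?thesis .
next
  case False
  have "(\<Sum>i\<in>{0<..T}. real i powr (a - 1)) \<le> (\<Sum>i\<in>{0<..T}. real T powr (a - 1))"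
    using False by (intro sum_mono powr_mono2) auto
  also have "\<dots> = real T powr 1 * real T powr (a - 1)" by simp
  also have "\<dots> = real T powr a" by (simp only: powr_add[symmetric]) simp
  also have "\<dots> \<le> (1 + 1 / a) * real T powr a"
    using a mult_right_mono[of 1 "1 + 1 / a" "real T powr a"] by simp
  finally show ?thesis .
qed

text \<open>
  Splitting \<open>ln (16 t ^ 2 / \<delta>)\<close> into \<open>ln (16 / \<delta>)\<close> and \<open>2 ln t\<close> leaves at most two factors \<open>1 + ln t\<close>, and
  each is bounded by a multiple of \<open>t powr ((1 - p) / 2)\<close>.  This removes the logarithm in \<open>t\<close> from the
  rate of the inner objective.
\<close>

lemma conf_log_absorb:
  assumes \<delta>: "0 < \<delta>" "\<delta> < 1" and p: "p < 1" and q: "1 \<le> q" "q \<le> t"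
  shows "c_fac t q * conf \<delta> t \<le> (1 + 2 / (1 - p))\<^sup>2 * real t powr (1 - p) * sqrt (ln (16 / \<delta>))"
proof -
  let ?q0 = "sqrt (ln (16 / \<delta>))" and ?l = "ln (real t)"
  have t: "1 \<le> real t" using q by simp
  have l: "0 \<le> ?l" using t by simp
  have q0: "1 \<le> ?q0" using conf_ge_1[OF \<delta>, of 1] by (simp add: conf_def)
  have "(conf \<delta> t)\<^sup>2 = ln (16 * (real t)\<^sup>2 / \<delta>)"
    using conf_ge_1[OF \<delta>, of t] q by (simp add: conf_def)
  also have "\<dots> = ln (16 / \<delta>) + 2 * ?l"
  proof -
    have "ln (16 / \<delta> * (real t)\<^sup>2) = ln (16 / \<delta>) + 2 * ?l" using \<delta> t by (subst ln_mult_pos) (auto simp: ln_realpow)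
    then show ?thesis by simp
  qed
  also have "ln (16 / \<delta>) = ?q0\<^sup>2" using \<delta> by simp
  also have "?q0\<^sup>2 + 2 * ?l \<le> ?q0\<^sup>2 * (1 + ?l)\<^sup>2"
  proof -
    have "1 \<le> ?q0\<^sup>2" using q0 by simp
    then have "2 * ?l \<le> ?q0\<^sup>2 * (2 * ?l)" using l mult_right_mono[of 1 "?q0\<^sup>2" "2 * ?l"] by simp
    also have "\<dots> \<le> ?q0\<^sup>2 * (2 * ?l + ?l\<^sup>2)" by (intro mult_left_mono) auto
    finally show ?thesis by (simp add: power2_sum algebra_simps)
  qed
  finally have "(conf \<delta> t)\<^sup>2 \<le> (?q0 * (1 + ?l))\<^sup>2" by (simp add: power_mult_distrib)
  then have conf: "conf \<delta> t \<le> ?q0 * (1 + ?l)"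
    by (rule power2_le_imp_le) (use q0 l in simp)
  let ?e = "(1 - p) / 2"
  have "1 + ?l \<le> (1 + 2 / (1 - p)) * real t powr ?e"
  proof -
    have "?l \<le> real t powr ?e / ?e" using t p by (intro ln_powr_bound) auto
    moreover have "1 \<le> real t powr ?e" using t p by (intro ge_one_powr_ge_zero) auto
    ultimately have "1 + ?l \<le> real t powr ?e + real t powr ?e / ?e" by (rule add_mono[rotated])
    also have "\<dots> = (1 + 2 / (1 - p)) * real t powr ?e" by (simp add: algebra_simps)
    finally show ?thesis .
  qed
  then have "(1 + ?l)\<^sup>2 \<le> ((1 + 2 / (1 - p)) * real t powr ?e)\<^sup>2" using l by (intro power_mono) auto
  also have "\<dots> = (1 + 2 / (1 - p))\<^sup>2 * real t powr (1 - p)"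
    by (simp add: power_mult_distrib power2_eq_square[of "real t powr ?e"] powr_add[symmetric])
  finally have l2: "(1 + ?l)\<^sup>2 \<le> (1 + 2 / (1 - p))\<^sup>2 * real t powr (1 - p)" .
  have "c_fac t q * conf \<delta> t \<le> (1 + ?l) * (?q0 * (1 + ?l))"
    using c_fac_bounds[OF q] conf conf_ge_1[OF \<delta>, of t] q l by (intro mult_mono) auto
  also have "\<dots> = (1 + ?l)\<^sup>2 * ?q0" by (simp add: power2_eq_square)
  also have "\<dots> \<le> (1 + 2 / (1 - p))\<^sup>2 * real t powr (1 - p) * ?q0"
    using l2 q0 by (intro mult_right_mono) auto
  finally show ?thesis .
qed

section \<open>Rates and limits from the weighted descent inequality\<close>

lemma outer_rate:
  assumes par: "0 < \<zeta>" "0 < p" "p < 1" "1 \<le> q" "q \<le> T" and \<delta>: "0 < \<delta>" "\<delta> < 1" and C: "0 \<le> C"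
    and y: "S_weight (reg_sigma \<zeta> p q) q T * y \<le> C * (c_fac T q * real T * conf \<delta> T)"
  shows "y \<le> C / \<zeta> * c_fac T q * real T powr (- (1 - p)) * conf \<delta> T"
proof -
  let ?P = "real T powr (1 - p)"
  let ?R = "C * (c_fac T q * real T * conf \<delta> T)"
  have R: "0 \<le> ?R" using C c_fac_bounds(1)[of q T] conf_ge_1[OF \<delta>, of T] par by simp
  have P: "0 < \<zeta> * (real T * ?P)" using par by simp
  have S: "\<zeta> * (real T * ?P) \<le> S_weight (reg_sigma \<zeta> p q) q T" by (rule S_weight_bounds[OF par])
  have "y \<le> ?R / S_weight (reg_sigma \<zeta> p q) q T"
    using y P S by (simp add: field_simps)
  also have "\<dots> \<le> ?R / (\<zeta> * (real T * ?P))"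
    using R P S by (intro divide_left_mono) auto
  also have "\<dots> = C / \<zeta> * c_fac T q * real T powr (- (1 - p)) * conf \<delta> T"
    using par unfolding powr_minus_divide[of _ "1 - p"] by (simp add: field_simps)
  finally show ?thesis .
qed

text \<open>
  Since \<open>a \<ge> - gl\<close>, the terms in \<open>a\<close> are at least \<open>- gl\<close> times the total weight, which is of order
  \<open>T powr (2 - p)\<close>.  Dividing by \<open>T * T\<close> leaves \<open>T powr - p\<close>.
\<close>

lemma inner_rate:
  fixes a b :: "nat \<Rightarrow> real"
  assumes par: "0 < \<zeta>" "0 < p" "p < 1" "1 \<le> q" "q \<le> T" and \<delta>: "0 < \<delta>" "\<delta> < 1"
    and C: "0 \<le> C" and gl: "0 \<le> gl" and a: "\<And>i. - gl \<le> a i"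
    and main: "real ((T + 1) * T) * reg_sigma \<zeta> p q T * a T + (\<Sum>i\<in>{q<..T}. late_weight \<zeta> p q i * a i)
      + real ((T + 1) * T) * b T \<le> C * (c_fac T q * real T * conf \<delta> T)"
    and b: "0 \<le> b T"
  shows "b T \<le> (C * (1 + 2 / (1 - p))\<^sup>2 + 3 * \<zeta> * gl) * real T powr (- p) * sqrt (ln (16 / \<delta>))"
proof -
  let ?q0 = "sqrt (ln (16 / \<delta>))" and ?P = "real T powr (1 - p)" and ?E = "(1 + 2 / (1 - p))\<^sup>2"
  have T: "1 \<le> real T" using par by simp
  have q0: "1 \<le> ?q0" using conf_ge_1[OF \<delta>, of 1] by (simp add: conf_def)
  have "- gl * S_weight (reg_sigma \<zeta> p q) q T
      \<le> real ((T + 1) * T) * reg_sigma \<zeta> p q T * a T + (\<Sum>i\<in>{q<..T}. late_weight \<zeta> p q i * a i)"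
  proof -
    have "real ((T + 1) * T) * reg_sigma \<zeta> p q T * (- gl) \<le> real ((T + 1) * T) * reg_sigma \<zeta> p q T * a T"
      using par a[of T] by (intro mult_left_mono) (auto simp: reg_sigma_def)
    moreover have "(\<Sum>i\<in>{q<..T}. late_weight \<zeta> p q i * (- gl)) \<le> (\<Sum>i\<in>{q<..T}. late_weight \<zeta> p q i * a i)"
      using par a by (intro sum_mono mult_left_mono late_weight_bounds) auto
    ultimately show ?thesis
      unfolding S_weight_eq sum_distrib_right[symmetric] by (simp only: distrib_left mult.commute[of _ "- gl"])
  qed
  moreover have "gl * S_weight (reg_sigma \<zeta> p q) q T \<le> gl * (3 * \<zeta> * (real T * ?P))"
    using gl S_weight_bounds[OF par] by (intro mult_left_mono) auto
  moreover have "real T * real T * b T \<le> real ((T + 1) * T) * b T"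
    using b by (intro mult_right_mono) (auto simp: algebra_simps)
  moreover have "C * (c_fac T q * real T * conf \<delta> T) \<le> C * (?E * ?P * ?q0 * real T)"
    using C mult_right_mono[OF conf_log_absorb[OF \<delta> par(3-5)], of "real T"]
    by (intro mult_left_mono) (auto simp: algebra_simps)
  moreover have "gl * (3 * \<zeta> * (real T * ?P)) * 1 \<le> gl * (3 * \<zeta> * (real T * ?P)) * ?q0"
    using gl par q0 by (intro mult_left_mono) auto
  ultimately have "real T * real T * b T \<le> C * (?E * ?P * ?q0 * real T) + gl * (3 * \<zeta> * (real T * ?P)) * ?q0"
    using main by linarith
  also have "\<dots> = real T * ((C * ?E + 3 * \<zeta> * gl) * ?P * ?q0)" by (simp add: algebra_simps)
  finally have "real T * b T \<le> (C * ?E + 3 * \<zeta> * gl) * ?P * ?q0" using T by simp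
  also have "?P = real T * real T powr (- p)" using T powr_add[of "real T" 1 "- p"] by simp
  finally have "real T * b T \<le> real T * ((C * ?E + 3 * \<zeta> * gl) * real T powr (- p) * ?q0)"
    by (simp add: algebra_simps)
  then show ?thesis using T by simp
qed

text \<open>
  The weighted sum of \<open>i powr - p\<close> has terms of order \<open>i powr (1 - 2 * p)\<close>.  As \<open>2 - 2 * p > 0\<close>, it is of order
  \<open>T powr (2 - 2 * p)\<close>, that is, \<open>T powr - p\<close> times the total weight, without a logarithm.
\<close>

lemma averaged_inner_rate:
  fixes b :: "nat \<Rightarrow> real"
  assumes par: "0 < \<zeta>" "0 < p" "p < 1" "1 \<le> q" "q \<le> T" and K: "0 \<le> K"
    and b: "\<And>i. q \<le> i \<Longrightarrow> b i \<le> K * real i powr (- p)"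
    and y: "S_weight (reg_sigma \<zeta> p q) q T * y
      \<le> real ((T + 1) * T) * reg_sigma \<zeta> p q T * b T + (\<Sum>i\<in>{q<..T}. late_weight \<zeta> p q i * b i)"
  shows "y \<le> K * (3 + 1 / (2 - 2 * p)) * real T powr (- p)"
proof -
  let ?P = "real T powr (1 - p)" and ?\<kappa> = "1 + 1 / (2 - 2 * p)"
  have T: "1 \<le> real T" using par by simp
  have split: "real i powr (1 - p) * real i powr (- p) = real i powr (2 - 2 * p - 1)" for i
    by (simp add: powr_add[symmetric])
  have "real ((T + 1) * T) * reg_sigma \<zeta> p q T * b T
      \<le> 2 * \<zeta> * (real T * ?P) * (K * real T powr (- p))"
  proof -
    have "real ((T + 1) * T) * reg_sigma \<zeta> p q T * b T
        \<le> real ((T + 1) * T) * reg_sigma \<zeta> p q T * (K * real T powr (- p))"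
      using par b by (intro mult_left_mono) (auto simp: reg_sigma_def)
    also have "\<dots> \<le> 2 * \<zeta> * (real T * ?P) * (K * real T powr (- p))"
      using last_weight_bounds(2)[OF par] K by (intro mult_right_mono) auto
    finally show ?thesis .
  qed
  moreover have "(\<Sum>i\<in>{q<..T}. late_weight \<zeta> p q i * b i)
      \<le> \<zeta> * K * (?\<kappa> * (real T * ?P * real T powr (- p)))"
  proof -
    have "(\<Sum>i\<in>{q<..T}. late_weight \<zeta> p q i * b i)
        \<le> (\<Sum>i\<in>{q<..T}. \<zeta> * real i powr (1 - p) * (K * real i powr (- p)))"
    proof (rule sum_mono)
      fix i assume i: "i \<in> {q<..T}"
      have "late_weight \<zeta> p q i * b i \<le> late_weight \<zeta> p q i * (K * real i powr (- p))"
        using par i b by (intro mult_left_mono late_weight_bounds) auto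
      also have "\<dots> \<le> \<zeta> * real i powr (1 - p) * (K * real i powr (- p))"
        using par i K by (intro mult_right_mono late_weight_bounds) auto
      finally show "late_weight \<zeta> p q i * b i \<le> \<zeta> * real i powr (1 - p) * (K * real i powr (- p))" .
    qed
    also have "\<dots> = \<zeta> * K * (\<Sum>i\<in>{q<..T}. real i powr (2 - 2 * p - 1))"
      unfolding split[symmetric] sum_distrib_left by (simp only: ac_simps)
    also have "\<dots> \<le> \<zeta> * K * (\<Sum>i\<in>{0<..T}. real i powr (2 - 2 * p - 1))"
      using par K by (intro mult_left_mono sum_mono2) auto
    also have "\<dots> \<le> \<zeta> * K * (?\<kappa> * real T powr (2 - 2 * p))"
      using par K sum_powr_bound[of "2 - 2 * p" T] by (intro mult_left_mono) auto
    also have "real T powr (2 - 2 * p) = real T * ?P * real T powr (- p)"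
      using T split[of T] powr_add[of "real T" 1 "2 - 2 * p - 1"] by (simp add: algebra_simps)
    finally show ?thesis .
  qed
  ultimately have y': "S_weight (reg_sigma \<zeta> p q) q T * y
      \<le> \<zeta> * (real T * ?P) * (K * (3 + 1 / (2 - 2 * p)) * real T powr (- p))"
    using y by (simp add: algebra_simps)
  have rhs: "0 \<le> K * (3 + 1 / (2 - 2 * p)) * real T powr (- p)" using K par by simp
  show ?thesis
  proof (rule ccontr)
    assume "\<not> ?thesis"
    then have lt: "K * (3 + 1 / (2 - 2 * p)) * real T powr (- p) < y" by simp
    have pos: "0 < \<zeta> * (real T * ?P)" using par by simp
    have "\<zeta> * (real T * ?P) * (K * (3 + 1 / (2 - 2 * p)) * real T powr (- p)) < \<zeta> * (real T * ?P) * y"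
      using lt pos by (rule mult_strict_left_mono)
    also have "\<dots> \<le> S_weight (reg_sigma \<zeta> p q) q T * y"
      using S_weight_bounds(1)[OF par] lt rhs by (intro mult_right_mono) auto
    finally show False using y' by simp
  qed
qed

lemma average_tendsto_0:
  fixes e :: "nat \<Rightarrow> real"
  assumes e: "e \<longlonglongrightarrow> 0" and nonneg: "\<And>i. 0 \<le> e i"
  shows "(\<lambda>T. (\<Sum>i\<in>{q<..T}. e i) / real T) \<longlonglongrightarrow> 0"
proof (rule LIMSEQ_I)
  fix r :: real assume r: "0 < r"
  obtain N where N: "\<And>i. N \<le> i \<Longrightarrow> e i < r / 2"
    using order_tendstoD(2)[OF e, of "r / 2"] r by (auto simp: eventually_sequentially)
  define H where "H = (\<Sum>i<N. e i)"
  obtain N' where N': "2 * H / r < real N'" using reals_Archimedean2 by blast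
  show "\<exists>no. \<forall>T\<ge>no. norm ((\<Sum>i\<in>{q<..T}. e i) / real T - 0) < r"
  proof (intro exI allI impI)
    fix T assume T: "max 1 N' \<le> T"
    then have Tpos: "0 < real T" by simp
    have "(\<Sum>i\<in>{q<..T}. e i) \<le> (\<Sum>i\<in>{q<..T}. (if i < N then e i else 0) + r / 2)"
      using N r by (intro sum_mono) (auto simp: not_less less_imp_le)
    also have "\<dots> = (\<Sum>i\<in>{q<..T} \<inter> {..<N}. e i) + real (T - q) * (r / 2)"
      by (simp add: sum.distrib sum.inter_restrict)
    also have "(\<Sum>i\<in>{q<..T} \<inter> {..<N}. e i) \<le> H"
      unfolding H_def using nonneg by (intro sum_mono2) auto
    also have "real (T - q) * (r / 2) \<le> real T * (r / 2)" using r by (intro mult_right_mono) auto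
    also have "H < real T * (r / 2)"
    proof -
      have "2 * H / r < real T" using N' T by linarith
      then show ?thesis using r by (simp add: field_simps)
    qed
    finally have "(\<Sum>i\<in>{q<..T}. e i) < r * real T" by (simp add: mult.commute)
    then have "(\<Sum>i\<in>{q<..T}. e i) / real T < r" by (simp only: pos_divide_less_eq[OF Tpos])
    moreover have "0 \<le> (\<Sum>i\<in>{q<..T}. e i) / real T"
      using nonneg by (simp add: sum_nonneg)
    ultimately show "norm ((\<Sum>i\<in>{q<..T}. e i) / real T - 0) < r" by simp
  qed
qed

text \<open>
  Dividing the inequality by the weight of \<open>a T\<close> bounds \<open>a T\<close> by a null sequence plus an average of the
  negative parts of the earlier \<open>a i\<close>: the weights satisfy \<open>late_weight i \<le> \<zeta> * T powr (1 - p)\<close>, and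
  there are at most \<open>T\<close> of them, so an unweighted Cesaro mean suffices.
\<close>

lemma last_iterate_limit:
  fixes a b :: "nat \<Rightarrow> real"
  assumes par: "0 < \<zeta>" "0 < p" "p < 1" "1 \<le> q" and \<delta>: "0 < \<delta>" "\<delta> < 1" and C: "0 \<le> C"
    and main: "\<And>T. q \<le> T \<Longrightarrow> real ((T + 1) * T) * reg_sigma \<zeta> p q T * a T
      + (\<Sum>i\<in>{q<..T}. late_weight \<zeta> p q i * a i) + real ((T + 1) * T) * b T
      \<le> C * (c_fac T q * real T * conf \<delta> T)"
    and b: "\<And>i. 0 \<le> b i" and neg: "(\<lambda>i. max 0 (- a i)) \<longlonglongrightarrow> 0"
  shows "a \<longlonglongrightarrow> 0"
proof -
  let ?e = "\<lambda>i. max 0 (- a i)"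
  let ?E = "(1 + 2 / (1 - (1 + p) / 2))\<^sup>2 * sqrt (ln (16 / \<delta>))"
  define up where "up T = C / \<zeta> * ?E * real T powr (- ((1 - p) / 2)) + (\<Sum>i\<in>{q<..T}. ?e i) / real T" for T
  have upper: "a T \<le> up T" if T: "q \<le> T" for T
  proof -
    let ?P = "real T powr (1 - p)"
    have T1: "1 \<le> real T" and P: "0 < ?P" using par T by auto
    define s where "s = (\<Sum>i\<in>{q<..T}. ?e i)"
    have s: "0 \<le> s" unfolding s_def by (intro sum_nonneg) simp
    have "(\<Sum>i\<in>{q<..T}. - (\<zeta> * ?P) * ?e i) \<le> (\<Sum>i\<in>{q<..T}. late_weight \<zeta> p q i * a i)"
    proof (rule sum_mono)
      fix i assume i: "i \<in> {q<..T}"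
      have "late_weight \<zeta> p q i \<le> \<zeta> * real i powr (1 - p)"
        using par i by (intro late_weight_bounds) auto
      also have "\<dots> \<le> \<zeta> * ?P" using par i by (intro mult_left_mono powr_mono2) auto
      finally have "late_weight \<zeta> p q i * ?e i \<le> \<zeta> * ?P * ?e i" by (rule mult_right_mono) simp
      moreover have "late_weight \<zeta> p q i * (- a i) \<le> late_weight \<zeta> p q i * ?e i"
        using par i by (intro mult_left_mono late_weight_bounds) auto
      ultimately show "- (\<zeta> * ?P) * ?e i \<le> late_weight \<zeta> p q i * a i" by simp
    qed
    then have ws: "- (\<zeta> * ?P * s) \<le> (\<Sum>i\<in>{q<..T}. late_weight \<zeta> p q i * a i)"
      by (simp add: s_def sum_distrib_left sum_negf)
    \<comment> \<open>The exponent \<open>(1 + p) / 2\<close> in place of \<open>p\<close> leaves a decaying factor after division by \<open>T powr (1 - p)\<close>.\<close>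
    have "c_fac T q * conf \<delta> T \<le> ?E * real T powr (1 - (1 + p) / 2)"
      using conf_log_absorb[OF \<delta>, of "(1 + p) / 2" q T] par T by (simp add: algebra_simps)
    also have "real T powr (1 - (1 + p) / 2) = ?P * real T powr (- ((1 - p) / 2))"
      unfolding powr_add[symmetric] by (simp add: field_simps)
    finally have "C * real T * (c_fac T q * conf \<delta> T) \<le> C * real T * (?E * (?P * real T powr (- ((1 - p) / 2))))"
      using C by (intro mult_left_mono) auto
    then have cq: "C * (c_fac T q * real T * conf \<delta> T)
        \<le> \<zeta> * (real T * ?P) * (C / \<zeta> * ?E * real T powr (- ((1 - p) / 2)))"
      using par by (simp add: algebra_simps)
    have "real ((T + 1) * T) * reg_sigma \<zeta> p q T * a T \<le> \<zeta> * (real T * ?P) * up T"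
    proof -
      have "\<zeta> * ?P * s = \<zeta> * (real T * ?P) * (s / real T)" using T1 by simp
      moreover have "0 \<le> real ((T + 1) * T) * b T" using b by simp
      ultimately show ?thesis
        using main[OF T] cq ws unfolding up_def s_def[symmetric] distrib_left by linarith
    qed
    moreover have "0 \<le> up T"
      using C par \<delta> s T1 by (auto simp: up_def s_def intro!: add_nonneg_nonneg mult_nonneg_nonneg)
    moreover have "\<zeta> * (real T * ?P) * a T \<le> real ((T + 1) * T) * reg_sigma \<zeta> p q T * a T" if "0 \<le> a T"
      using last_weight_bounds(1)[OF par T] that by (rule mult_right_mono)
    ultimately show "a T \<le> up T"
      using par T1 P by (cases "0 \<le> a T") (auto dest: order_trans simp: mult_le_cancel_left)
  qed
  have "up \<longlonglongrightarrow> C / \<zeta> * ?E * 0 + 0"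
    unfolding up_def using par neg
    by (intro tendsto_add tendsto_mult tendsto_const tendsto_neg_powr filterlim_real_sequentially average_tendsto_0) auto
  then have "up \<longlonglongrightarrow> 0" by simp
  moreover have "(\<lambda>i. - ?e i) \<longlonglongrightarrow> 0" using tendsto_minus[OF neg] by simp
  moreover have "\<forall>\<^sub>F T in sequentially. a T \<le> up T"
    using upper eventually_sequentially by auto
  ultimately show ?thesis
    by (intro tendsto_sandwich[of "\<lambda>i. - ?e i" a sequentially up]) (auto intro!: always_eventually)
qed

section \<open>Bilevel optimality\<close>

lemma argmin_set_iff: "y \<in> argmin_set X h \<longleftrightarrow> y \<in> X \<and> (\<forall>z\<in>X. h y \<le> (h z :: real))"
  by (auto simp: argmin_set_def is_arg_min_def not_less)

lemma compact_sublevel: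
  fixes h :: "'b::metric_space \<Rightarrow> real"
  assumes "compact X" "continuous_on X h"
  shows "compact {y \<in> X. h y \<le> c}"
proof -
  have "closedin (top_of_set X) (X \<inter> h -` {..c})"
    by (rule continuous_closedin_preimage[OF assms(2)]) simp
  then have "compact (X \<inter> h -` {..c})" using assms(1) closedin_compact by blast
  moreover have "X \<inter> h -` {..c} = {y \<in> X. h y \<le> c}" by auto
  ultimately show ?thesis by simp
qed

lemma bilevel_solution:
  fixes F G :: "'b::metric_space \<Rightarrow> real"
  assumes X: "compact X" "X \<noteq> {}" and F: "continuous_on X F" and G: "continuous_on X G"
  obtains s where "s \<in> X" "G s = (INF z\<in>X. G z)" "F s = bilevel_opt X F G"
    "\<And>y. y \<in> X \<Longrightarrow> G s \<le> G y" "\<And>y. y \<in> X \<Longrightarrow> G y \<le> G s \<Longrightarrow> F s \<le> F y"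
proof -
  obtain y where y: "y \<in> X" "\<And>z. z \<in> X \<Longrightarrow> G y \<le> G z"
    using continuous_attains_inf[OF X G] by blast
  have "G z \<le> G w" if "G z \<le> G y" "w \<in> X" for z w
    using that(1) y(2)[OF that(2)] by (rule order_trans)
  then have arg: "argmin_set X G = {z \<in> X. G z \<le> G y}"
    using y(1) by (auto simp: argmin_set_iff)
  have "compact (argmin_set X G)" unfolding arg by (rule compact_sublevel[OF X(1) G])
  moreover have "argmin_set X G \<noteq> {}" using y arg by auto
  moreover have "continuous_on (argmin_set X G) F"
    using F by (rule continuous_on_subset) (auto simp: arg)
  ultimately obtain s where s: "s \<in> argmin_set X G" "\<And>z. z \<in> argmin_set X G \<Longrightarrow> F s \<le> F z"
    using continuous_attains_inf[of "argmin_set X G" F] by auto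
  have sX: "s \<in> X" "\<And>z. z \<in> X \<Longrightarrow> G s \<le> G z" using s(1) by (auto simp: argmin_set_iff)
  show ?thesis
  proof (rule that)
    show "G s = (INF z\<in>X. G z)" using sX by (intro cInf_eq_minimum[symmetric]) auto
    show "F s = bilevel_opt X F G"
      unfolding bilevel_opt_def using s by (intro cInf_eq_minimum[symmetric]) auto
    show "F s \<le> F z" if "z \<in> X" "G z \<le> G s" for z
      using that sX s(2)[of z] by (auto simp: argmin_set_iff intro: order_trans)
  qed (use sX in auto)
qed

text \<open>
  If \<open>F\<close> stayed below \<open>F s - r\<close> at some points \<open>y t\<close>, these would lie in a compact sublevel set of \<open>F\<close>
  on which \<open>G\<close> attains a minimum.  That minimum exceeds \<open>G s\<close> because \<open>s\<close> is bilevel optimal, so \<open>y t\<close> leaves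
  the set once \<open>G (y t)\<close> is close enough to \<open>G s\<close>.
\<close>

lemma outer_gap_limit:
  fixes F G :: "'b::metric_space \<Rightarrow> real"
  assumes X: "compact X" and F: "continuous_on X F" and G: "continuous_on X G"
    and opt: "\<And>z. z \<in> X \<Longrightarrow> G s \<le> G z" "\<And>z. z \<in> X \<Longrightarrow> G z \<le> G s \<Longrightarrow> F s \<le> F z"
    and y: "\<And>t. y t \<in> X" and lim: "(\<lambda>t. G (y t) - G s) \<longlonglongrightarrow> 0"
  shows "(\<lambda>t. max 0 (- (F (y t) - F s))) \<longlonglongrightarrow> 0"
proof (rule LIMSEQ_I)
  fix r :: real assume r: "0 < r"
  define K where "K = {z \<in> X. F z \<le> F s - r}"
  have "\<forall>\<^sub>F t in sequentially. y t \<notin> K"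
  proof (cases "K = {}")
    case False
    have "compact K" unfolding K_def by (rule compact_sublevel[OF X F])
    then obtain k where k: "k \<in> K" "\<And>z. z \<in> K \<Longrightarrow> G k \<le> G z"
      using False continuous_attains_inf[of K G] continuous_on_subset[OF G, of K]
      by (auto simp: K_def)
    have "\<not> G k \<le> G s" using k(1) opt(2)[of k] r by (auto simp: K_def)
    then have "\<forall>\<^sub>F t in sequentially. G (y t) - G s < G k - G s"
      using order_tendstoD(2)[OF lim, of "G k - G s"] by simp
    then show ?thesis by eventually_elim (use k(2) in force)
  qed simp
  then obtain N where N: "\<And>t. N \<le> t \<Longrightarrow> y t \<notin> K" by (auto simp: eventually_sequentially)
  show "\<exists>N. \<forall>t\<ge>N. norm (max 0 (- (F (y t) - F s)) - 0) < r"
  proof (intro exI allI impI)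
    fix t assume "N \<le> t"
    then have "F s - r < F (y t)" using N[of t] y[of t] by (simp add: K_def)
    then show "norm (max 0 (- (F (y t) - F s)) - 0) < r" using r by (simp add: max_def)
  qed
qed

section \<open>The algorithm\<close>

lemma step_alpha_le_epoch_rate:
  assumes q: "1 \<le> q" and r: "q * (t div q) \<le> r" "r < t"
  shows "step_alpha q r \<le> epoch_rate q t"
proof (cases "t < q")
  case True
  then show ?thesis using r q by (simp add: step_alpha_def epoch_rate_def divide_right_mono)
next
  case False
  have "1 \<le> t div q" using False q by (simp add: div_greater_zero_iff Suc_le_eq)
  then have "q * 1 \<le> q * (t div q)" by (rule mult_le_mono2)
  then have qr: "q \<le> r" using r(1) by linarith
  have "t = q * (t div q) + t mod q" "t mod q < q" using q by auto
  then have "t < r + r" using r(1) qr by linarith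
  then show ?thesis using qr False by (simp add: step_alpha_def epoch_rate_def field_simps)
qed

lemma epoch_rate_pos: "1 \<le> q \<Longrightarrow> 0 < epoch_rate q t"
  by (auto simp: epoch_rate_def add_pos_nonneg)

lemma sums_telescoping_inverse: "(\<lambda>t. \<delta> / (real (t + 1) * real (t + 2))) sums \<delta>"
proof -
  have "(\<lambda>t. \<delta> * inverse (real (Suc t))) \<longlonglongrightarrow> \<delta> * 0"
    by (intro tendsto_mult tendsto_const LIMSEQ_inverse_real_of_nat)
  then have "(\<lambda>t. \<delta> / (real t + 1)) \<longlonglongrightarrow> 0"
    by (simp add: divide_inverse add.commute)
  from telescope_sums'[OF this]
  have "(\<lambda>t. \<delta> / (real t + 1) - \<delta> / (real (Suc t) + 1)) sums \<delta>" by simp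
  moreover have "\<delta> / (real t + 1) - \<delta> / (real (Suc t) + 1) = \<delta> / (real (t + 1) * real (t + 2))" for t
    by (simp add: divide_simps) (simp add: algebra_simps)
  ultimately show ?thesis by simp
qed

text \<open>
  If \<open>X\<close> is a single point, \<open>assumption_A\<close> also holds with negative \<open>Lf\<close> and \<open>Lg\<close>; absolute values are
  therefore used for the constants throughout.
\<close>

locale ir_fscg_run =
  fixes V X :: "'b::real_inner set" and n q :: nat and f g :: "nat \<Rightarrow> 'b \<Rightarrow> real"
    and D Lf Lg \<zeta> p :: real and x0 :: 'b and B :: "nat \<Rightarrow> (nat list \<times> nat list) pmf"
    and v x :: "nat \<Rightarrow> sample_path \<Rightarrow> 'b"
  assumes V: "subspace V" and A: "assumption_A V X n f g D Lf Lg" and qn: "q \<in> {1..n}"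
    and batches: "uniform_batches n q B"
    and run: "ir_fscg V X n f g (step_alpha q) (reg_sigma \<zeta> p q) q q x0 v x"
    and \<zeta>: "0 < \<zeta>" and p: "0 < p" "p < 1"
begin

abbreviation "F \<equiv> avg n f"
abbreviation "G \<equiv> avg n g"
abbreviation "\<sigma> \<equiv> reg_sigma \<zeta> p q"
abbreviation "\<alpha> \<equiv> step_alpha q"

lemma q: "1 \<le> q" and n: "0 < n" using qn by auto

lemma X: "X \<subseteq> V" "convex X" "compact X" "x0 \<in> X" "convex_on X F" "convex_on X G"
  and diam: "y \<in> X \<Longrightarrow> z \<in> X \<Longrightarrow> norm (y - z) \<le> \<bar>D\<bar>"
  and C1: "C1_near V X F" "C1_near V X G"
  and C1_summands: "i \<in> {1..n} \<Longrightarrow> C1_near V X (f i)" "i \<in> {1..n} \<Longrightarrow> C1_near V X (g i)"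
  using A run by (force simp: assumption_A_def ir_fscg_def)+

lemma lipschitz_summands:
  assumes "i \<in> {1..n}" "y \<in> X" "z \<in> X"
  shows "norm (grad V (f i) y - grad V (f i) z) \<le> \<bar>Lf\<bar> * norm (y - z)"
    "norm (grad V (g i) y - grad V (g i) z) \<le> \<bar>Lg\<bar> * norm (y - z)"
proof -
  have "norm (grad V (f i) y - grad V (f i) z) \<le> Lf * norm (y - z)"
    "norm (grad V (g i) y - grad V (g i) z) \<le> Lg * norm (y - z)"
    using A assms by (auto simp: assumption_A_def)
  then show "norm (grad V (f i) y - grad V (f i) z) \<le> \<bar>Lf\<bar> * norm (y - z)"
    "norm (grad V (g i) y - grad V (g i) z) \<le> \<bar>Lg\<bar> * norm (y - z)"
    by (meson abs_ge_self mult_right_mono norm_ge_zero order_trans)+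
qed

lemma path: "ir_fscg_path V X n f g \<alpha> \<sigma> q q x0 (\<lambda>t. fst (\<omega> t)) (\<lambda>t. snd (\<omega> t))
    (\<lambda>t. v t \<omega>) (\<lambda>t. x t \<omega>)"
  using run by (simp add: ir_fscg_def)

lemma x_0: "x 0 \<omega> = x0" and x_Suc: "x (Suc t) \<omega> = x t \<omega> + \<alpha> t *\<^sub>R (v t \<omega> - x t \<omega>)"
  and v_in: "v t \<omega> \<in> X"
  and v_min: "z \<in> X \<Longrightarrow>
    (\<sigma> t *\<^sub>R grad_est V n f q q (\<lambda>s. fst (\<omega> s)) (\<lambda>s. x s \<omega>) t
      + grad_est V n g q q (\<lambda>s. snd (\<omega> s)) (\<lambda>s. x s \<omega>) t) \<bullet> v t \<omega>
    \<le> (\<sigma> t *\<^sub>R grad_est V n f q q (\<lambda>s. fst (\<omega> s)) (\<lambda>s. x s \<omega>) t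
      + grad_est V n g q q (\<lambda>s. snd (\<omega> s)) (\<lambda>s. x s \<omega>) t) \<bullet> z"
  using path[of \<omega>] by (auto simp: ir_fscg_path_def argmin_set_iff)

lemma x_in: "x t \<omega> \<in> X"
proof (induction t)
  case 0
  then show ?case using X by (simp add: x_0)
next
  case (Suc t)
  have "(1 - \<alpha> t) *\<^sub>R x t \<omega> + \<alpha> t *\<^sub>R v t \<omega> \<in> X"
    using X(2) Suc v_in step_alpha_bounds[OF q] by (intro convexD) auto
  then show ?case by (simp add: x_Suc algebra_simps)
qed

lemma x_adapted: "depends_below t (x t)"
proof (induction t)
  case 0
  then show ?case by (simp add: depends_below_def x_0)
next
  case (Suc t)
  have "depends_below (Suc t) (v t)"
    using run unfolding ir_fscg_def nonanticipating_def depends_below_def by (meson less_Suc_eq_le)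
  with depends_below_mono[OF Suc, of "Suc t"]
  have "depends_below (Suc t) (\<lambda>\<omega>. x t \<omega> + \<alpha> t *\<^sub>R (v t \<omega> - x t \<omega>))"
    by (intro depends_below_comp2[of _ "x t" "v t" "\<lambda>a b. a + \<alpha> t *\<^sub>R (b - a)"]) auto
  then show ?case by (simp add: x_Suc[abs_def] depends_below_def)
qed

lemma x_step: "norm (x (Suc t) \<omega> - x t \<omega>) \<le> \<alpha> t * \<bar>D\<bar>"
  using step_alpha_bounds[OF q, of t] diam[OF v_in x_in] by (simp add: x_Suc mult_left_mono)

sublocale VF: variance_reduced V X n q f "\<bar>Lf\<bar>" B fst x "\<lambda>t. \<alpha> t * \<bar>D\<bar>"
proof
  show "real n *\<^sub>R grad V (avg n f) y = (\<Sum>i\<in>{1..n}. grad V (f i) y)" if "y \<in> X" for y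
    using C1_summands X n that by (intro grad_avg[OF V]) auto
  show "map_pmf fst (B t) = replicate_pmf q (pmf_of_set {1..n})" for t
    using batches by (simp add: uniform_batches_def)
qed (use q n lipschitz_summands x_in x_adapted x_step in auto)

sublocale VG: variance_reduced V X n q g "\<bar>Lg\<bar>" B snd x "\<lambda>t. \<alpha> t * \<bar>D\<bar>"
proof
  show "real n *\<^sub>R grad V (avg n g) y = (\<Sum>i\<in>{1..n}. grad V (g i) y)" if "y \<in> X" for y
    using C1_summands X n that by (intro grad_avg[OF V]) auto
  show "map_pmf snd (B t) = replicate_pmf q (pmf_of_set {1..n})" for t
    using batches by (simp add: uniform_batches_def)
qed (use q n lipschitz_summands x_in x_adapted x_step in auto)

text \<open>
  The summand \<open>1\<close> keeps the variance bound positive when the Lipschitz constant or the diameter is 0.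
\<close>

definition err_scale_F :: real where "err_scale_F = 2 * \<bar>Lf\<bar> * \<bar>D\<bar> + 1"
definition err_scale_G :: real where "err_scale_G = 2 * \<bar>Lg\<bar> * \<bar>D\<bar> + 1"

definition accurate :: "real \<Rightarrow> sample_path set"
  where "accurate \<delta> = {\<omega>. \<forall>t. norm (VF.err t \<omega>) \<le> 2 * (err_scale_F * epoch_rate q t) * conf \<delta> (Suc t) \<and>
    norm (VG.err t \<omega>) \<le> 2 * (err_scale_G * epoch_rate q t) * conf \<delta> (Suc t)}"

text \<open>
  At time \<open>t\<close> each estimator may fail with probability \<open>\<delta> / (2 (t + 1) (t + 2))\<close>; doubled and summed over
  \<open>t\<close>, this telescopes to \<open>\<delta>\<close>.
\<close>

lemma accurate:
  assumes \<delta>: "0 < \<delta>" "\<delta> < 1"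
  shows "accurate \<delta> \<in> sets VF.M" "1 - \<delta> \<le> measure VF.M (accurate \<delta>)"
proof -
  interpret prob_space VF.M by (rule prob_space_sample_measure)
  show sets: "accurate \<delta> \<in> sets VF.M"
  proof -
    have "{\<omega>. norm (VF.err t \<omega>) \<le> 2 * (err_scale_F * epoch_rate q t) * conf \<delta> (Suc t) \<and>
        norm (VG.err t \<omega>) \<le> 2 * (err_scale_G * epoch_rate q t) * conf \<delta> (Suc t)} \<in> sets VF.M" for t
      by (rule sets_depends_below[OF depends_below_comp2[OF VF.err_adapted VG.err_adapted]])
    then have "(\<Inter>t. {\<omega>. norm (VF.err t \<omega>) \<le> 2 * (err_scale_F * epoch_rate q t) * conf \<delta> (Suc t) \<and>
        norm (VG.err t \<omega>) \<le> 2 * (err_scale_G * epoch_rate q t) * conf \<delta> (Suc t)}) \<in> sets VF.M"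
      by (intro sets.countable_INT) auto
    also have "(\<Inter>t. {\<omega>. norm (VF.err t \<omega>) \<le> 2 * (err_scale_F * epoch_rate q t) * conf \<delta> (Suc t) \<and>
        norm (VG.err t \<omega>) \<le> 2 * (err_scale_G * epoch_rate q t) * conf \<delta> (Suc t)}) = accurate \<delta>"
      by (auto simp: accurate_def)
    finally show ?thesis .
  qed
  define \<epsilon> where "\<epsilon> t = \<delta> / (2 * real (t + 1) * real (t + 2))" for t
  have \<epsilon>: "0 < \<epsilon> t" "\<epsilon> t < 1" for t
  proof -
    show "0 < \<epsilon> t" using \<delta> by (simp add: \<epsilon>_def)
    have "1 \<le> 2 * real (t + 1) * real (t + 2)" by (simp add: algebra_simps)
    then show "\<epsilon> t < 1" using \<delta> unfolding \<epsilon>_def by (subst pos_divide_less_eq) auto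
  qed
  have level: "sqrt (ln (2 / \<epsilon> t)) \<le> conf \<delta> (Suc t)" for t
  proof -
    have "2 / \<epsilon> t = 4 * (real (t + 1) * real (t + 2)) / \<delta>" using \<delta> by (simp add: \<epsilon>_def)
    also have "\<dots> \<le> 16 * (real (Suc t))\<^sup>2 / \<delta>"
      using \<delta> by (intro divide_right_mono) (auto simp: power2_eq_square algebra_simps)
    finally have "ln (2 / \<epsilon> t) \<le> ln (16 * (real (Suc t))\<^sup>2 / \<delta>)"
      using \<epsilon>[of t] \<delta> by (subst ln_le_cancel_iff) auto
    then show ?thesis by (simp add: conf_def)
  qed
  define badF where "badF t = {\<omega>. norm (VF.err t \<omega>) > 2 * (err_scale_F * epoch_rate q t) * sqrt (ln (2 / \<epsilon> t))}" for t
  define badG where "badG t = {\<omega>. norm (VG.err t \<omega>) > 2 * (err_scale_G * epoch_rate q t) * sqrt (ln (2 / \<epsilon> t))}" for t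
  have step: "2 * L * (\<alpha> r * \<bar>D\<bar>) \<le> (2 * L * \<bar>D\<bar> + 1) * epoch_rate q t"
    if "0 \<le> L" "q * (t div q) \<le> r" "r < t" for L r t
  proof -
    have "2 * L * \<bar>D\<bar> * \<alpha> r \<le> 2 * L * \<bar>D\<bar> * epoch_rate q t"
      using that step_alpha_le_epoch_rate[OF q that(2,3)] by (intro mult_left_mono) auto
    then show ?thesis using epoch_rate_pos[OF q, of t] by (simp add: algebra_simps)
  qed
  have posF: "0 < err_scale_F * epoch_rate q t" and posG: "0 < err_scale_G * epoch_rate q t" for t
    using epoch_rate_pos[OF q, of t] by (auto simp: err_scale_F_def err_scale_G_def intro!: mult_pos_pos add_nonneg_pos)
  have F: "badF t \<in> sets VF.M" "measure VF.M (badF t) \<le> \<epsilon> t" for t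
  proof -
    have "2 * \<bar>Lf\<bar> * (\<alpha> r * \<bar>D\<bar>) \<le> err_scale_F * epoch_rate q t" if "q * (t div q) \<le> r" "r < t" for r
      using step[OF _ that, of "\<bar>Lf\<bar>"] by (simp add: err_scale_F_def)
    note tail = VF.err_tail[OF posF[of t] this \<epsilon>[of t]]
    show "badF t \<in> sets VF.M" "measure VF.M (badF t) \<le> \<epsilon> t"
      unfolding badF_def using tail by auto
  qed
  have G: "badG t \<in> sets VF.M" "measure VF.M (badG t) \<le> \<epsilon> t" for t
  proof -
    have "2 * \<bar>Lg\<bar> * (\<alpha> r * \<bar>D\<bar>) \<le> err_scale_G * epoch_rate q t" if "q * (t div q) \<le> r" "r < t" for r
      using step[OF _ that, of "\<bar>Lg\<bar>"] by (simp add: err_scale_G_def)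
    note tail = VG.err_tail[OF posG[of t] this \<epsilon>[of t]]
    show "badG t \<in> sets VF.M" "measure VF.M (badG t) \<le> \<epsilon> t"
      unfolding badG_def using tail by auto
  qed
  have FG: "measure VF.M (badF t \<union> badG t) \<le> \<delta> / (real (t + 1) * real (t + 2))" for t
  proof -
    have "measure VF.M (badF t \<union> badG t) \<le> \<epsilon> t + \<epsilon> t"
      using measure_Un_le[OF F(1)[of t] G(1)[of t]] F(2)[of t] G(2)[of t] by linarith
    also have "\<epsilon> t + \<epsilon> t = \<delta> / (real (t + 1) * real (t + 2))"
    proof -
      have "d / (2 * a * b) + d / (2 * a * b) = d / (a * b)" for d a b :: real
        by (cases "a = 0"; cases "b = 0") (auto simp: field_simps)
      then show ?thesis unfolding \<epsilon>_def .
    qed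
    finally show ?thesis .
  qed
  have sm: "summable (\<lambda>t. measure VF.M (badF t \<union> badG t))"
    by (rule summable_comparison_test'[OF sums_summable[OF sums_telescoping_inverse[of \<delta>]], of 0])
      (use FG in auto)
  have "measure VF.M (\<Union>t. badF t \<union> badG t) \<le> (\<Sum>t. measure VF.M (badF t \<union> badG t))"
    using F G sm by (intro finite_measure_subadditive_countably) auto
  also have "\<dots> \<le> \<delta>"
    by (rule sums_le[OF FG summable_sums[OF sm] sums_telescoping_inverse])
  finally have bad: "measure VF.M (\<Union>t. badF t \<union> badG t) \<le> \<delta>" .
  have U: "(\<Union>t. badF t \<union> badG t) \<in> sets VF.M" using F G by auto
  have good: "\<omega> \<in> accurate \<delta>" if "\<omega> \<notin> (\<Union>t. badF t \<union> badG t)" for \<omega>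
    unfolding accurate_def
  proof (intro CollectI allI conjI)
    fix t
    have "norm (VF.err t \<omega>) \<le> 2 * (err_scale_F * epoch_rate q t) * sqrt (ln (2 / \<epsilon> t))"
      using that by (simp add: badF_def not_less)
    also have "\<dots> \<le> 2 * (err_scale_F * epoch_rate q t) * conf \<delta> (Suc t)"
      using posF[of t] level[of t] by (intro mult_left_mono) auto
    finally show "norm (VF.err t \<omega>) \<le> 2 * (err_scale_F * epoch_rate q t) * conf \<delta> (Suc t)" .
    have "norm (VG.err t \<omega>) \<le> 2 * (err_scale_G * epoch_rate q t) * sqrt (ln (2 / \<epsilon> t))"
      using that by (simp add: badG_def not_less)
    also have "\<dots> \<le> 2 * (err_scale_G * epoch_rate q t) * conf \<delta> (Suc t)"
      using posG[of t] level[of t] by (intro mult_left_mono) auto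
    finally show "norm (VG.err t \<omega>) \<le> 2 * (err_scale_G * epoch_rate q t) * conf \<delta> (Suc t)" .
  qed
  have "1 - \<delta> \<le> measure VF.M (space VF.M - (\<Union>t. badF t \<union> badG t))"
    using bad prob_compl[OF U] by simp
  also have "\<dots> \<le> measure VF.M (accurate \<delta>)"
    using good sets by (intro finite_measure_mono) auto
  finally show "1 - \<delta> \<le> measure VF.M (accurate \<delta>)" .
qed

lemma cont: "continuous_on X F" "continuous_on X G"
  using C1_near_imp_continuous_on[OF V X(1)] C1 by auto

lemma gradF: "y \<in> X \<Longrightarrow> has_gradient V F y (grad V F y)"
  and gradG: "y \<in> X \<Longrightarrow> has_gradient V G y (grad V G y)"
  using has_gradient_grad[OF V X(1)] C1 by auto

lemma lipschitz_avg:
  assumes "y \<in> X" "z \<in> X"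
  shows "norm (grad V F y - grad V F z) \<le> \<bar>Lf\<bar> * norm (y - z)"
    "norm (grad V G y - grad V G z) \<le> \<bar>Lg\<bar> * norm (y - z)"
proof -
  have *: "norm (grad V (avg n h) y - grad V (avg n h) z) \<le> L * norm (y - z)"
    if h: "\<And>i. i \<in> {1..n} \<Longrightarrow> C1_near V X (h i)"
      "\<And>i. i \<in> {1..n} \<Longrightarrow> norm (grad V (h i) y - grad V (h i) z) \<le> L * norm (y - z)" for h L
  proof -
    have "real n *\<^sub>R (grad V (avg n h) y - grad V (avg n h) z)
        = (\<Sum>i\<in>{1..n}. grad V (h i) y - grad V (h i) z)"
      by (simp only: scaleR_diff_right grad_avg[OF V X(1) h(1) n assms(1)]
          grad_avg[OF V X(1) h(1) n assms(2)] sum_subtractf)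
    then have "real n * norm (grad V (avg n h) y - grad V (avg n h) z)
        = norm (\<Sum>i\<in>{1..n}. grad V (h i) y - grad V (h i) z)"
      by (metis abs_of_nat norm_scaleR)
    also have "\<dots> \<le> (\<Sum>i\<in>{1..n}. L * norm (y - z))" by (intro sum_norm_le h)
    finally have "real n * norm (grad V (avg n h) y - grad V (avg n h) z) \<le> real n * (L * norm (y - z))"
      by simp
    then show ?thesis using n by simp
  qed
  show "norm (grad V F y - grad V F z) \<le> \<bar>Lf\<bar> * norm (y - z)"
    "norm (grad V G y - grad V G z) \<le> \<bar>Lg\<bar> * norm (y - z)"
    using C1_summands lipschitz_summands assms by (auto intro!: *)
qed

text \<open>
  Bounds both \<open>\<bar>D\<bar>\<close> times the gradient error, in units of \<open>2 * epoch_rate q t * conf \<delta> (t + 1)\<close>, and the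
  curvature constant \<open>(\<sigma> t * \<bar>Lf\<bar> + \<bar>Lg\<bar>) * \<bar>D\<bar> ^ 2\<close> of the regularised objective.
\<close>

definition noise_const :: real where "noise_const = \<bar>D\<bar> * (\<zeta> * err_scale_F + err_scale_G)"

lemma \<sigma>_bounds: "0 \<le> \<sigma> t" "\<sigma> t \<le> \<zeta>"
  using \<zeta> p powr_mono[of "- p" 0 "real (max t q) + 1"] by (auto simp: reg_sigma_def mult_left_le)

lemma noise_const_nonneg: "0 \<le> noise_const"
  using \<zeta> by (auto simp: noise_const_def err_scale_F_def err_scale_G_def intro!: mult_nonneg_nonneg add_nonneg_nonneg)

lemma descent:
  assumes \<omega>: "\<omega> \<in> accurate \<delta>" and \<delta>: "0 < \<delta>" "\<delta> < 1" and s: "s \<in> X"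
  shows "\<sigma> t * (F (x (Suc t) \<omega>) - F s) + (G (x (Suc t) \<omega>) - G s)
    \<le> (1 - \<alpha> t) * (\<sigma> t * (F (x t \<omega>) - F s) + (G (x t \<omega>) - G s))
      + noise_const * (2 * \<alpha> t * epoch_rate q t * conf \<delta> (Suc t) + (\<alpha> t)\<^sup>2 / 2)"
proof -
  let ?y = "x t \<omega>" and ?y' = "x (Suc t) \<omega>"
  let ?eF = "grad_est V n f q q (\<lambda>s. fst (\<omega> s)) (\<lambda>s. x s \<omega>) t"
  let ?eG = "grad_est V n g q q (\<lambda>s. snd (\<omega> s)) (\<lambda>s. x s \<omega>) t"
  let ?r = "epoch_rate q t * conf \<delta> (Suc t)"
  note \<alpha> = step_alpha_bounds[OF q, of t]
  have "\<sigma> t * (F ?y' - F s) + (G ?y' - G s) \<le> (1 - \<alpha> t) * (\<sigma> t * (F ?y - F s) + (G ?y - G s))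
      + \<alpha> t * (\<bar>D\<bar> * (\<sigma> t * norm (?eF - grad V F ?y) + norm (?eG - grad V G ?y)))
      + (\<alpha> t)\<^sup>2 * ((\<sigma> t * \<bar>Lf\<bar> + \<bar>Lg\<bar>) * \<bar>D\<bar>\<^sup>2 / 2)"
  proof (rule inexact_conditional_gradient_step[where v = "v t \<omega>"])
    show "F ?y' \<le> F ?y + grad V F ?y \<bullet> (?y' - ?y) + \<bar>Lf\<bar> / 2 * (norm (?y' - ?y))\<^sup>2"
      by (rule smooth_below_quadratic[OF V X(1,2) x_in x_in gradF lipschitz_avg(1)[OF _ x_in]])
    show "G ?y' \<le> G ?y + grad V G ?y \<bullet> (?y' - ?y) + \<bar>Lg\<bar> / 2 * (norm (?y' - ?y))\<^sup>2"
      by (rule smooth_below_quadratic[OF V X(1,2) x_in x_in gradG lipschitz_avg(2)[OF _ x_in]])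
    show "F ?y + grad V F ?y \<bullet> (s - ?y) \<le> F s"
      by (rule convex_above_gradient[OF V X(1,5) x_in s gradF[OF x_in]])
    show "G ?y + grad V G ?y \<bullet> (s - ?y) \<le> G s"
      by (rule convex_above_gradient[OF V X(1,6) x_in s gradG[OF x_in]])
  qed (use \<alpha> \<sigma>_bounds diam v_in x_in s x_Suc v_min[OF s] in auto)
  also have "\<alpha> t * (\<bar>D\<bar> * (\<sigma> t * norm (?eF - grad V F ?y) + norm (?eG - grad V G ?y)))
      \<le> \<alpha> t * (\<bar>D\<bar> * (\<zeta> * (2 * (err_scale_F * ?r)) + 2 * (err_scale_G * ?r)))"
  proof -
    have "norm (?eF - grad V F ?y) \<le> 2 * (err_scale_F * ?r)" "norm (?eG - grad V G ?y) \<le> 2 * (err_scale_G * ?r)"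
      using \<omega> by (auto simp: accurate_def VF.err_def VG.err_def mult.assoc)
    then show ?thesis
      using \<alpha> \<sigma>_bounds[of t] \<zeta> by (intro mult_left_mono add_mono mult_mono) auto
  qed
  also have "\<dots> = noise_const * (2 * \<alpha> t * epoch_rate q t * conf \<delta> (Suc t))"
    by (simp add: noise_const_def algebra_simps)
  also have "(\<alpha> t)\<^sup>2 * ((\<sigma> t * \<bar>Lf\<bar> + \<bar>Lg\<bar>) * \<bar>D\<bar>\<^sup>2 / 2) \<le> (\<alpha> t)\<^sup>2 * (noise_const / 2)"
  proof -
    have "(\<sigma> t * \<bar>Lf\<bar> + \<bar>Lg\<bar>) * \<bar>D\<bar>\<^sup>2 = \<bar>D\<bar> * (\<sigma> t * (\<bar>Lf\<bar> * \<bar>D\<bar>) + \<bar>Lg\<bar> * \<bar>D\<bar>)"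
      by (simp only: power2_eq_square distrib_left distrib_right ac_simps)
    also have "\<dots> \<le> noise_const"
      unfolding noise_const_def using \<sigma>_bounds[of t] \<zeta>
      by (intro mult_left_mono add_mono mult_mono) (auto simp: err_scale_F_def err_scale_G_def)
    finally show ?thesis by (intro mult_left_mono divide_right_mono) auto
  qed
  finally show ?thesis by (simp add: algebra_simps)
qed

definition gap_F_low :: real where "gap_F_low = bilevel_opt X F G - (INF y\<in>X. F y)"
definition gap_F_up :: real where "gap_F_up = (SUP y\<in>X. F y) - bilevel_opt X F G"
definition gap_G_up :: real where "gap_G_up = (SUP y\<in>X. G y) - (INF y\<in>X. G y)"
definition descent_const :: real where "descent_const = 4 * (\<zeta> * gap_F_up + gap_G_up) + 30 * noise_const"
definition inner_const :: real where "inner_const = descent_const * (1 + 2 / (1 - p))\<^sup>2 + 3 * \<zeta> * gap_F_low"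

lemma gap_bounds:
  assumes "y \<in> X"
  shows "- gap_F_low \<le> F y - bilevel_opt X F G" "F y - bilevel_opt X F G \<le> gap_F_up"
    "0 \<le> G y - (INF y\<in>X. G y)" "G y - (INF y\<in>X. G y) \<le> gap_G_up"
proof -
  have "bounded (F ` X)" "bounded (G ` X)"
    using X(3) cont by (auto intro!: compact_imp_bounded compact_continuous_image)
  then have "bdd_below (F ` X)" "bdd_above (F ` X)" "bdd_below (G ` X)" "bdd_above (G ` X)"
    by (auto intro: bounded_imp_bdd_below bounded_imp_bdd_above)
  then show "- gap_F_low \<le> F y - bilevel_opt X F G" "F y - bilevel_opt X F G \<le> gap_F_up"
    "0 \<le> G y - (INF y\<in>X. G y)" "G y - (INF y\<in>X. G y) \<le> gap_G_up"
    using assms by (auto simp: gap_F_low_def gap_F_up_def gap_G_up_def intro: cINF_lower cSUP_upper)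
qed

lemma solution:
  obtains s where "s \<in> X" "G s = (INF y\<in>X. G y)" "F s = bilevel_opt X F G"
    "\<And>y. y \<in> X \<Longrightarrow> G s \<le> G y" "\<And>y. y \<in> X \<Longrightarrow> G y \<le> G s \<Longrightarrow> F s \<le> F y"
  using bilevel_solution[OF X(3) _ cont] X(4) by blast

lemma gaps_nonneg: "0 \<le> gap_F_low" "0 \<le> gap_F_up" "0 \<le> gap_G_up" "0 \<le> descent_const" "0 \<le> inner_const"
proof -
  obtain s where "s \<in> X" "F s = bilevel_opt X F G" by (rule solution) (rule that)
  then show g: "0 \<le> gap_F_low" "0 \<le> gap_F_up" "0 \<le> gap_G_up"
    using gap_bounds[of s] by auto
  then show "0 \<le> descent_const" using \<zeta> noise_const_nonneg by (simp add: descent_const_def)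
  then show "0 \<le> inner_const" using \<zeta> g by (simp add: inner_const_def)
qed

lemma main_inequality:
  assumes \<omega>: "\<omega> \<in> accurate \<delta>" and \<delta>: "0 < \<delta>" "\<delta> < 1" and T: "q \<le> T"
  shows "real ((T + 1) * T) * \<sigma> T * (F (x T \<omega>) - bilevel_opt X F G)
      + (\<Sum>i\<in>{q<..T}. late_weight \<zeta> p q i * (F (x i \<omega>) - bilevel_opt X F G))
      + real ((T + 1) * T) * (G (x T \<omega>) - (INF y\<in>X. G y))
    \<le> descent_const * (c_fac T q * real T * conf \<delta> T)"
proof -
  obtain s where s: "s \<in> X" "G s = (INF y\<in>X. G y)" "F s = bilevel_opt X F G" by (rule solution) (rule that)
  show ?thesis
    unfolding descent_const_def late_weight_def
    by (rule weighted_descent[where a = "\<lambda>i. F (x i \<omega>) - bilevel_opt X F G"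
          and b = "\<lambda>i. G (x i \<omega>) - (INF y\<in>X. G y)",
          OF \<zeta> p(1) q \<delta> noise_const_nonneg gap_bounds(2)[OF x_in] gaps_nonneg(2) gap_bounds(4)[OF x_in]
            gaps_nonneg(3) descent[OF \<omega> \<delta> s(1), unfolded s(2,3)] T])
qed

lemma inner_rate_last:
  assumes "\<omega> \<in> accurate \<delta>" "0 < \<delta>" "\<delta> < 1" "q \<le> T"
  shows "G (x T \<omega>) - (INF y\<in>X. G y) \<le> inner_const * real T powr (- p) * sqrt (ln (16 / \<delta>))"
  unfolding inner_const_def
  by (rule inner_rate[where a = "\<lambda>i. F (x i \<omega>) - bilevel_opt X F G"
          and b = "\<lambda>i. G (x i \<omega>) - (INF y\<in>X. G y)", OF \<zeta> p q assms(4,2,3) gaps_nonneg(4,1) gap_bounds(1)[OF x_in]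
        main_inequality[OF assms] gap_bounds(3)[OF x_in]])

lemma outer_rate_avg:
  assumes "\<omega> \<in> accurate \<delta>" "0 < \<delta>" "\<delta> < 1" "q \<le> T"
  shows "F (z_avg \<sigma> q (\<lambda>t. x t \<omega>) T) - bilevel_opt X F G
    \<le> descent_const / \<zeta> * c_fac T q * real T powr (- (1 - p)) * conf \<delta> T"
proof (rule outer_rate[OF \<zeta> p q assms(4,2,3) gaps_nonneg(4)])
  have "0 \<le> real ((T + 1) * T) * (G (x T \<omega>) - (INF y\<in>X. G y))"
    using gap_bounds(3)[OF x_in] by (intro mult_nonneg_nonneg) auto
  then show "S_weight \<sigma> q T * (F (z_avg \<sigma> q (\<lambda>t. x t \<omega>) T) - bilevel_opt X F G)
      \<le> descent_const * (c_fac T q * real T * conf \<delta> T)"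
    using convex_on_z_avg[where x = "\<lambda>t. x t \<omega>" and level = "bilevel_opt X F G",
        OF \<zeta> p q assms(4) X(5,2) x_in] main_inequality[OF assms] by linarith
qed

lemma inner_rate_avg:
  assumes "\<omega> \<in> accurate \<delta>" "0 < \<delta>" "\<delta> < 1" "q \<le> T"
  shows "G (z_avg \<sigma> q (\<lambda>t. x t \<omega>) T) - (INF y\<in>X. G y)
    \<le> inner_const * (3 + 1 / (2 - 2 * p)) * real T powr (- p) * sqrt (ln (16 / \<delta>))"
proof -
  let ?q0 = "sqrt (ln (16 / \<delta>))"
  have K: "0 \<le> inner_const * ?q0" using gaps_nonneg assms by simp
  have "G (z_avg \<sigma> q (\<lambda>t. x t \<omega>) T) - (INF y\<in>X. G y)
      \<le> inner_const * ?q0 * (3 + 1 / (2 - 2 * p)) * real T powr (- p)"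
    using inner_rate_last[OF assms(1-3)]
    by (intro averaged_inner_rate[OF \<zeta> p q assms(4) K _ convex_on_z_avg[OF \<zeta> p q assms(4) X(6,2) x_in]])
      (simp add: ac_simps)
  then show ?thesis by (simp add: ac_simps)
qed

lemma last_iterate:
  assumes "\<omega> \<in> accurate \<delta>" "0 < \<delta>" "\<delta> < 1"
  shows "(\<lambda>t. F (x t \<omega>)) \<longlonglongrightarrow> bilevel_opt X F G" "(\<lambda>t. G (x t \<omega>)) \<longlonglongrightarrow> (INF y\<in>X. G y)"
proof -
  obtain s where s: "s \<in> X" "G s = (INF y\<in>X. G y)" "F s = bilevel_opt X F G"
      "\<And>y. y \<in> X \<Longrightarrow> G s \<le> G y" "\<And>y. y \<in> X \<Longrightarrow> G y \<le> G s \<Longrightarrow> F s \<le> F y"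
    by (rule solution) (rule that)
  have "(\<lambda>t. inner_const * real t powr (- p) * sqrt (ln (16 / \<delta>))) \<longlonglongrightarrow> inner_const * 0 * sqrt (ln (16 / \<delta>))"
    using p by (intro tendsto_mult tendsto_const tendsto_neg_powr filterlim_real_sequentially) auto
  then have lim: "(\<lambda>t. inner_const * real t powr (- p) * sqrt (ln (16 / \<delta>))) \<longlonglongrightarrow> 0" by simp
  have G0: "(\<lambda>t. G (x t \<omega>) - (INF y\<in>X. G y)) \<longlonglongrightarrow> 0"
  proof (rule tendsto_sandwich[OF _ _ tendsto_const lim])
    show "\<forall>\<^sub>F t in sequentially. 0 \<le> G (x t \<omega>) - (INF y\<in>X. G y)"
      using gap_bounds(3)[OF x_in] by (intro always_eventually) blast
    show "\<forall>\<^sub>F t in sequentially. G (x t \<omega>) - (INF y\<in>X. G y) \<le> inner_const * real t powr (- p) * sqrt (ln (16 / \<delta>))"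
      using inner_rate_last[OF assms] by (auto simp: eventually_sequentially)
  qed
  then show "(\<lambda>t. G (x t \<omega>)) \<longlonglongrightarrow> (INF y\<in>X. G y)" by (simp add: LIM_zero_iff)
  have "(\<lambda>t. max 0 (- (F (x t \<omega>) - F s))) \<longlonglongrightarrow> 0"
    using G0 by (intro outer_gap_limit[OF X(3) cont s(4,5) x_in]) (simp_all add: s)
  then have neg: "(\<lambda>t. max 0 (- (F (x t \<omega>) - bilevel_opt X F G))) \<longlonglongrightarrow> 0" by (simp only: s(3))
  have "(\<lambda>t. F (x t \<omega>) - bilevel_opt X F G) \<longlonglongrightarrow> 0"
    by (rule last_iterate_limit[where a = "\<lambda>i. F (x i \<omega>) - bilevel_opt X F G"
          and b = "\<lambda>i. G (x i \<omega>) - (INF y\<in>X. G y)", OF \<zeta> p q assms(2,3) gaps_nonneg(4) main_inequality[OF assms]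
          gap_bounds(3)[OF x_in] neg])
  then show "(\<lambda>t. F (x t \<omega>)) \<longlonglongrightarrow> bilevel_opt X F G" by (simp add: LIM_zero_iff)
qed

lemma z_adapted: "depends_below (Suc t) (\<lambda>\<omega>. z_avg \<sigma> q (\<lambda>s. x s \<omega>) t)"
proof -
  have "x i \<omega> = x i \<omega>'" if "\<forall>s<Suc t. \<omega> s = \<omega>' s" "i \<le> t" for i \<omega> \<omega>'
    by (rule depends_belowD[OF x_adapted]) (use that in simp)
  then show ?thesis unfolding depends_below_def z_avg_def by (auto intro!: arg_cong2[where f = "(+)"] sum.cong)
qed

lemma sets_averaged_event: "{\<omega>. \<forall>t\<ge>q. P t (z_avg \<sigma> q (\<lambda>s. x s \<omega>) t)} \<in> sets VF.M"
proof -
  have "{\<omega>. q \<le> t \<longrightarrow> P t (z_avg \<sigma> q (\<lambda>s. x s \<omega>) t)} \<in> sets VF.M" for t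
    by (rule sets_depends_below[OF depends_below_comp[OF z_adapted]])
  then have "(\<Inter>t. {\<omega>. q \<le> t \<longrightarrow> P t (z_avg \<sigma> q (\<lambda>s. x s \<omega>) t)}) \<in> sets VF.M"
    by (intro sets.countable_INT) auto
  also have "(\<Inter>t. {\<omega>. q \<le> t \<longrightarrow> P t (z_avg \<sigma> q (\<lambda>s. x s \<omega>) t)})
      = {\<omega>. \<forall>t\<ge>q. P t (z_avg \<sigma> q (\<lambda>s. x s \<omega>) t)}" by auto
  finally show ?thesis .
qed

text \<open>
  The limits hold on every event \<open>accurate \<delta>\<close>, hence on the union over \<open>\<delta> = 1 / (m + 2)\<close>, which has
  probability one.
\<close>

lemma almost_surely_accurate:
  "AE \<omega> in VF.M. \<exists>\<delta>. 0 < \<delta> \<and> \<delta> < 1 \<and> \<omega> \<in> accurate \<delta>"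
proof -
  interpret prob_space VF.M by (rule prob_space_sample_measure)
  let ?d = "\<lambda>m::nat. 1 / (real m + 2)"
  let ?U = "\<Union>m. accurate (?d m)"
  have U: "?U \<in> sets VF.M" by (intro sets.countable_UN) (auto intro!: accurate(1))
  have "1 - ?d m \<le> measure VF.M ?U" for m
  proof -
    have "1 - ?d m \<le> measure VF.M (accurate (?d m))" by (intro accurate(2)) auto
    also have "\<dots> \<le> measure VF.M ?U" using U by (intro finite_measure_mono) auto
    finally show ?thesis .
  qed
  moreover have "?d \<longlonglongrightarrow> 0"
    using LIMSEQ_ignore_initial_segment[OF lim_1_over_n[where 'a = real], of 2] by (simp add: add.commute)
  then have "(\<lambda>m. 1 - ?d m) \<longlonglongrightarrow> 1 - 0" by (intro tendsto_diff tendsto_const)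
  ultimately have "1 \<le> measure VF.M ?U"
    by (intro LIMSEQ_le_const2[of "\<lambda>m. 1 - ?d m"]) auto
  then have "measure VF.M ?U = 1" using prob_le_1[of ?U] by simp
  then have "AE \<omega> in VF.M. \<omega> \<in> ?U" using U by (simp add: prob_eq_1)
  then show ?thesis
  proof (rule AE_mp, intro AE_I2 impI)
    fix \<omega> assume "\<omega> \<in> ?U"
    then obtain m where "\<omega> \<in> accurate (?d m)" by blast
    then show "\<exists>\<delta>. 0 < \<delta> \<and> \<delta> < 1 \<and> \<omega> \<in> accurate \<delta>" by (intro exI[of _ "?d m"]) auto
  qed
qed

end

theorem theorem3:
  fixes Lf Lg D \<zeta> p gapF_low gapF_up gapG_up :: real
  assumes "\<zeta> > 0" and "0 < p" and "p < 1"
  shows "\<exists>C>0. \<forall>(d::nat) (X :: rseq set) (n::nat) f g (q::nat) x0 B v x.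
    (let F = avg n f; G = avg n g;
         Gopt = (INF z\<in>X. G z); Fopt = bilevel_opt X F G;
         \<sigma> = reg_sigma \<zeta> p q; M = sample_measure B;
         z = (\<lambda>t \<omega>. z_avg \<sigma> q (\<lambda>s. x s \<omega>) t)
     in
       assumption_A (rspace d) X n f g D Lf Lg \<longrightarrow>
       q \<in> {1..n} \<longrightarrow>
       uniform_batches n q B \<longrightarrow>
       ir_fscg (rspace d) X n f g (step_alpha q) \<sigma> q q x0 v x \<longrightarrow>
       Fopt - (INF y\<in>X. F y) = gapF_low \<longrightarrow>
       (SUP y\<in>X. F y) - Fopt = gapF_up \<longrightarrow>
       (SUP y\<in>X. G y) - Gopt = gapG_up \<longrightarrow>
         (\<forall>\<delta>. 0 < \<delta> \<and> \<delta> < 1 \<longrightarrow>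
            measure M {\<omega> \<in> space M. \<forall>t\<ge>q.
              F (z t \<omega>) - Fopt \<le>
                C * c_fac t q * real t powr (- (1 - p)) * sqrt (ln (16 * (real t)\<^sup>2 / \<delta>)) \<and>
              G (z t \<omega>) - Gopt \<le>
                C * real t powr (- p) * sqrt (ln (16 / \<delta>))} \<ge> 1 - \<delta>) \<and>
         (AE \<omega> in M. (\<lambda>t. F (x t \<omega>)) \<longlonglongrightarrow> Fopt \<and> (\<lambda>t. G (x t \<omega>)) \<longlonglongrightarrow> Gopt))"
proof -
  define CM where "CM = 4 * (\<zeta> * gapF_up + gapG_up)
    + 30 * (\<bar>D\<bar> * (\<zeta> * (2 * \<bar>Lf\<bar> * \<bar>D\<bar> + 1) + (2 * \<bar>Lg\<bar> * \<bar>D\<bar> + 1)))"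
  define CG where "CG = CM * (1 + 2 / (1 - p))\<^sup>2 + 3 * \<zeta> * gapF_low"
  \<comment> \<open>The gaps are only known to be nonnegative once a problem instance with these gaps is given; the
    absolute values make the constant positive without one.\<close>
  define C where "C = \<bar>CM / \<zeta>\<bar> + \<bar>CG * (3 + 1 / (2 - 2 * p))\<bar> + 1"
  show ?thesis
    unfolding Let_def
  proof (rule exI[of _ C], intro conjI allI impI)
    show "0 < C" unfolding C_def by (intro add_nonneg_pos add_nonneg_nonneg abs_ge_zero) simp
  next
    fix d :: nat and X :: "rseq set" and n f g and q :: nat and x0 B v x and \<delta> :: real
    assume hyps: "assumption_A (rspace d) X n f g D Lf Lg" "q \<in> {1..n}" "uniform_batches n q B"
        "ir_fscg (rspace d) X n f g (step_alpha q) (reg_sigma \<zeta> p q) q q x0 v x"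
      and gaps: "bilevel_opt X (avg n f) (avg n g) - (INF y\<in>X. avg n f y) = gapF_low"
        "(SUP y\<in>X. avg n f y) - bilevel_opt X (avg n f) (avg n g) = gapF_up"
        "(SUP y\<in>X. avg n g y) - (INF z\<in>X. avg n g z) = gapG_up"
      and \<delta>: "0 < \<delta> \<and> \<delta> < 1"
    interpret R: ir_fscg_run "rspace d" X n q f g D Lf Lg \<zeta> p x0 B v x
      by unfold_locales (use assms subspace_rspace hyps in auto)
    interpret prob_space "sample_measure B" by (rule prob_space_sample_measure)
    have CM: "R.descent_const = CM" and CG: "R.inner_const = CG"
      by (simp_all add: R.inner_const_def R.descent_const_def R.noise_const_def R.err_scale_F_def R.err_scale_G_def R.gap_F_low_def R.gap_F_up_def R.gap_G_up_def
          CM_def CG_def gaps)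
    have C: "CM / \<zeta> \<le> C" "CG * (3 + 1 / (2 - 2 * p)) \<le> C"
      using abs_ge_self[of "CM / \<zeta>"] abs_ge_self[of "CG * (3 + 1 / (2 - 2 * p))"]
        abs_ge_zero[of "CM / \<zeta>"] abs_ge_zero[of "CG * (3 + 1 / (2 - 2 * p))"]
      unfolding C_def by linarith+
    let ?z = "\<lambda>t \<omega>. z_avg (reg_sigma \<zeta> p q) q (\<lambda>s. x s \<omega>) t"
    let ?S = "{\<omega> \<in> space (sample_measure B). \<forall>t\<ge>q.
      avg n f (?z t \<omega>) - bilevel_opt X (avg n f) (avg n g)
        \<le> C * c_fac t q * real t powr (- (1 - p)) * sqrt (ln (16 * (real t)\<^sup>2 / \<delta>)) \<and>
      avg n g (?z t \<omega>) - (INF z\<in>X. avg n g z) \<le> C * real t powr (- p) * sqrt (ln (16 / \<delta>))}"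
    have "R.accurate \<delta> \<subseteq> ?S"
    proof (intro subsetI CollectI conjI allI impI)
      fix \<omega> t assume \<omega>: "\<omega> \<in> R.accurate \<delta>" and t: "q \<le> t"
      note run = \<omega> conjunct1[OF \<delta>] conjunct2[OF \<delta>] t
      have "R.descent_const / \<zeta> * c_fac t q * real t powr (- (1 - p)) * conf \<delta> t
          \<le> C * c_fac t q * real t powr (- (1 - p)) * conf \<delta> t"
        using C(1) c_fac_bounds(1)[OF R.q t] conf_ge_1[of \<delta> t] \<delta> R.q t unfolding CM
        by (intro mult_right_mono) auto
      then show "avg n f (?z t \<omega>) - bilevel_opt X (avg n f) (avg n g)
          \<le> C * c_fac t q * real t powr (- (1 - p)) * sqrt (ln (16 * (real t)\<^sup>2 / \<delta>))"
        using R.outer_rate_avg[OF run] by (simp add: conf_def)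
      have "R.inner_const * (3 + 1 / (2 - 2 * p)) * real t powr (- p) * sqrt (ln (16 / \<delta>))
          \<le> C * real t powr (- p) * sqrt (ln (16 / \<delta>))"
        using C(2) \<delta> unfolding CG by (intro mult_right_mono) auto
      then show "avg n g (?z t \<omega>) - (INF z\<in>X. avg n g z) \<le> C * real t powr (- p) * sqrt (ln (16 / \<delta>))"
        using R.inner_rate_avg[OF run] by linarith
    qed simp
    moreover have "?S \<in> sets (sample_measure B)"
      using R.sets_averaged_event[of "\<lambda>t z.
          avg n f z - bilevel_opt X (avg n f) (avg n g)
            \<le> C * c_fac t q * real t powr (- (1 - p)) * sqrt (ln (16 * (real t)\<^sup>2 / \<delta>)) \<and>
          avg n g z - (INF z\<in>X. avg n g z) \<le> C * real t powr (- p) * sqrt (ln (16 / \<delta>))"] by simp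
    ultimately have "measure (sample_measure B) (R.accurate \<delta>) \<le> measure (sample_measure B) ?S"
      by (rule finite_measure_mono)
    then show "1 - \<delta> \<le> measure (sample_measure B) ?S"
      using R.accurate(2)[of \<delta>] \<delta> by linarith
  next
    fix d :: nat and X :: "rseq set" and n f g and q :: nat and x0 B v x
    assume hyps: "assumption_A (rspace d) X n f g D Lf Lg" "q \<in> {1..n}" "uniform_batches n q B"
        "ir_fscg (rspace d) X n f g (step_alpha q) (reg_sigma \<zeta> p q) q q x0 v x"
    interpret R: ir_fscg_run "rspace d" X n q f g D Lf Lg \<zeta> p x0 B v x
      by unfold_locales (use assms subspace_rspace hyps in auto)
    show "AE \<omega> in sample_measure B.
        (\<lambda>t. avg n f (x t \<omega>)) \<longlonglongrightarrow> bilevel_opt X (avg n f) (avg n g) \<and>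
        (\<lambda>t. avg n g (x t \<omega>)) \<longlonglongrightarrow> (INF z\<in>X. avg n g z)"
      using R.almost_surely_accurate by (rule AE_mp) (use R.last_iterate in \<open>auto intro!: AE_I2\<close>)
  qed
qed

end
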